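(* Let $\gamma>0$ be a constant. There exists $h_0=h_0(\gamma)$ such that for every graph $H$ on $h\ge h_0$ vertices, if $k(H)\le(1-\gamma)h$, then $H$ is avoidable.
   Context: Let $k\ge 2$. A red-blue edge coloring of $K_k$ is identified with the graph on $k$ vertices formed by its blue edges (the red edges being the non-edges); $\mathcal{C}(k)$ is the set of all red-blue edge colorings of $K_k$, equivalently of all graphs on $k$ vertices, considered up to isomorphism. For $X\subseteq\mathcal{C}(k)$, an $X$-packing of a red-blue edge coloring of $K_n$ is a set of pairwise edge-disjoint colored copies of $K_k$ in this colored $K_n$, each isomorphic (as a colored graph) to an element of $X$; its size is the number of copies. (Equivalently: for the blue graph $G$ on $n$ vertices, a set of $k$-element vertex subsets, any two sharing at most one vertex, each inducing in $G$ a graph isomorphic to a member of $X$.) $X$ has the asymptotic packing property if for every $\epsilon>0$ and all sufficiently large $n$, every red-blue edge coloring of $K_n$ has an $X$-packing of size at least $\frac{n(n-1)}{k(k-1)}(1-\epsilon)$. A graph $C\in\mathcal{C}(k)$ is avoidable if $\mathcal{C}(k)\setminus\{C\}$ has the asymptotic packing property. A graph is asymmetric if its only automorphism is the identity, and symmetric otherwise. For an asymmetric graph $H$, $k(H)$ is the smallest positive integer $k$ such that any two distinct induced subgraphs of $H$ (i.e. induced by distinct vertex subsets) on at least $k$ vertices each are non-isomorphic and, further, any induced subgraph of $H$ on at least $k$ vertices is asymmetric. If $H$ is symmetric, $k(H)=\infty$. *)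

theory Defs
  imports Complex_Main "HOL-Library.Extended_Real"
begin

text \<open>A red-blue edge coloring of a complete graph is represented by its blue graph: a pair of
  the vertex set and the set of blue edges; a pair of distinct vertices that is not an edge
  is red. Vertices are natural numbers, which is no loss of generality for finite graphs.\<close>

type_synonym graph = "nat set \<times> nat set set"

abbreviation verts :: "graph \<Rightarrow> nat set" where
  "verts \<equiv> fst"

abbreviation edges :: "graph \<Rightarrow> nat set set" where
  "edges \<equiv> snd"

text \<open>The edges of the complete graph on a vertex set.\<close>

definition all_edges :: "nat set \<Rightarrow> nat set set" where
  "all_edges V = {e. e \<subseteq> V \<and> card e = 2}"

definition graphs :: "nat \<Rightarrow> graph set" where
  "graphs n = {G. finite (verts G) \<and> card (verts G) = n \<and> edges G \<subseteq> all_edges (verts G)}"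

definition induced :: "graph \<Rightarrow> nat set \<Rightarrow> graph" where
  "induced G S = (S, {e \<in> edges G. e \<subseteq> S})"

definition isomorphism :: "(nat \<Rightarrow> nat) \<Rightarrow> graph \<Rightarrow> graph \<Rightarrow> bool" where
  "isomorphism f G H \<longleftrightarrow> bij_betw f (verts G) (verts H) \<and>
     (\<forall>u\<in>verts G. \<forall>v\<in>verts G. {u, v} \<in> edges G \<longleftrightarrow> {f u, f v} \<in> edges H)"

definition isomorphic :: "graph \<Rightarrow> graph \<Rightarrow> bool" where
  "isomorphic G H \<longleftrightarrow> (\<exists>f. isomorphism f G H)"

text \<open>Functions are total, so an automorphism counts as the identity if it fixes every vertex.\<close>

definition asymmetric :: "graph \<Rightarrow> bool" where
  "asymmetric G \<longleftrightarrow> (\<forall>f. isomorphism f G G \<longrightarrow> (\<forall>v\<in>verts G. f v = v))"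

text \<open>Colorings of \<open>K\<^sub>k\<close> up to isomorphism, as isomorphism classes of graphs on \<open>k\<close> vertices.\<close>

definition iso_rel :: "nat \<Rightarrow> (graph \<times> graph) set" where
  "iso_rel k = {(G, H). G \<in> graphs k \<and> H \<in> graphs k \<and> isomorphic G H}"

definition iso_class :: "nat \<Rightarrow> graph \<Rightarrow> graph set" where
  "iso_class k G = iso_rel k `` {G}"

definition colorings :: "nat \<Rightarrow> graph set set" where
  "colorings k = graphs k // iso_rel k"

lemma isomorphic_refl: "isomorphic G G"
  unfolding isomorphic_def isomorphism_def by (rule exI[of _ id]) auto

lemma isomorphic_sym:
  assumes "isomorphic G H"
  shows "isomorphic H G"
proof -
  obtain f where f: "isomorphism f G H"
    using assms unfolding isomorphic_def by blast
  define g where "g = inv_into (verts G) f"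
  have b: "bij_betw f (verts G) (verts H)"
    using f unfolding isomorphism_def by blast
  have "bij_betw g (verts H) (verts G)"
    unfolding g_def using b by (rule bij_betw_inv_into)
  moreover have "{u, v} \<in> edges H \<longleftrightarrow> {g u, g v} \<in> edges G"
    if "u \<in> verts H" "v \<in> verts H" for u v
  proof -
    have "f (g u) = u" "f (g v) = v"
      using b that unfolding g_def by (auto intro: bij_betw_inv_into_right)
    moreover have "g u \<in> verts G" "g v \<in> verts G"
      using \<open>bij_betw g (verts H) (verts G)\<close> that by (auto simp: bij_betw_apply)
    ultimately show ?thesis
      using f unfolding isomorphism_def by metis
  qed
  ultimately show ?thesis
    unfolding isomorphic_def isomorphism_def by blast
qed

lemma isomorphic_trans:
  assumes "isomorphic G H" "isomorphic H K"
  shows "isomorphic G K"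
proof -
  obtain f g where f: "isomorphism f G H" and g: "isomorphism g H K"
    using assms unfolding isomorphic_def by blast
  have "bij_betw (g \<circ> f) (verts G) (verts K)"
    using f g unfolding isomorphism_def by (blast intro: bij_betw_trans)
  moreover have "\<forall>u\<in>verts G. f u \<in> verts H"
    using f unfolding isomorphism_def by (auto simp: bij_betw_apply)
  ultimately have "isomorphism (g \<circ> f) G K"
    using f g unfolding isomorphism_def by simp
  then show ?thesis
    unfolding isomorphic_def by blast
qed

lemma equiv_iso_rel: "equiv (graphs k) (iso_rel k)"
  by (rule equivI)
    (auto simp: iso_rel_def refl_on_def sym_def trans_def
      intro: isomorphic_refl isomorphic_sym isomorphic_trans)

text \<open>For \<open>X \<subseteq> colorings k\<close>. A copy of \<open>K\<^sub>k\<close> in the complete graph on the vertices of \<open>G\<close> is given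
  by its vertex set, and its coloring is the subgraph of \<open>G\<close> induced on that set.\<close>

definition is_packing :: "nat \<Rightarrow> graph set set \<Rightarrow> graph \<Rightarrow> nat set set \<Rightarrow> bool" where
  "is_packing k X G P \<longleftrightarrow>
     (\<forall>S\<in>P. S \<subseteq> verts G \<and> card S = k \<and> (\<exists>C\<in>\<Union>X. isomorphic (induced G S) C)) \<and>
     pairwise (\<lambda>S T. disjnt (all_edges S) (all_edges T)) P"

definition asymptotic_packing_property :: "nat \<Rightarrow> graph set set \<Rightarrow> bool" where
  "asymptotic_packing_property k X \<longleftrightarrow>
     (\<forall>\<epsilon>::real. \<epsilon> > 0 \<longrightarrow> (\<forall>\<^sub>F n in sequentially. \<forall>G\<in>graphs n. \<exists>P. is_packing k X G P \<and>
        real (card P) \<ge> (real n * (real n - 1)) / (real k * (real k - 1)) * (1 - \<epsilon>)))"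

definition avoidable :: "nat \<Rightarrow> graph \<Rightarrow> bool" where
  "avoidable k C \<longleftrightarrow> asymptotic_packing_property k (colorings k - {iso_class k C})"

definition induced_distinct_from :: "graph \<Rightarrow> nat \<Rightarrow> bool" where
  "induced_distinct_from H k \<longleftrightarrow>
     (\<forall>A B. A \<subseteq> verts H \<and> B \<subseteq> verts H \<and> A \<noteq> B \<and> card A \<ge> k \<and> card B \<ge> k \<longrightarrow>
        \<not> isomorphic (induced H A) (induced H B)) \<and>
     (\<forall>A. A \<subseteq> verts H \<and> card A \<ge> k \<longrightarrow> asymmetric (induced H A))"

text \<open>The parameter \<open>k(H)\<close>.\<close>

definition asym_index :: "graph \<Rightarrow> enat" where
  "asym_index H =
     (if asymmetric H then enat (LEAST k. k > 0 \<and> induced_distinct_from H k) else \<infinity>)"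

text \<open>For asymmetric \<open>H\<close> the minimum above is over a nonempty set.\<close>

lemma induced_distinct_from_Suc_card:
  assumes "finite (verts H)"
  shows "induced_distinct_from H (Suc (card (verts H)))"
proof -
  have "\<not> Suc (card (verts H)) \<le> card A" if "A \<subseteq> verts H" for A
    using card_mono[OF assms that] by simp
  then show ?thesis
    unfolding induced_distinct_from_def by blast
qed

end

theory Submission
  imports Defs
begin

text \<open>Let \<open>k = k(H)\<close>. If \<open>h\<close> is large, then \<open>k \<le> (1 - \<gamma>) h\<close> gives \<open>k \<le> h - 3\<close>, so that any two
  \<open>h\<close>-subsets of a set of \<open>h + 3\<close> vertices share at least \<open>k\<close> vertices. Two copies of \<open>H\<close> in a
  colored complete graph that share at least \<open>k\<close> vertices agree there on the identification with
  \<open>H\<close> (\<open>copies_agree\<close>). It follows that every set of \<open>h + 3\<close> vertices has a subset \<open>Y\<close> of at most six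
  vertices such that all copies of \<open>H\<close> in the large set omit only vertices of \<open>Y\<close>
  (\<open>copies_complement_cover\<close>).

  This is so restrictive that the \<open>h\<close>-subsets of the \<open>h + 3\<close> vertices that omit some vertex outside
  \<open>Y\<close> still admit nonnegative weights under which every pair of vertices is covered with total weight
  \<open>1\<close> (\<open>fractional_decomposition_avoiding_trace\<close>). So every coloring of a complete graph on
  \<open>h + 3\<close> vertices has a fractional decomposition into colored cliques on \<open>h\<close> vertices other than
  \<open>H\<close>. Averaging over all \<open>(h + 3)\<close>-subsets of \<open>n\<close> vertices gives such a fractional decomposition
  of the whole colored graph in which, in addition, any three vertices lie together in cliques of
  total weight \<open>O(1 / n)\<close> only (\<open>average_of_local_decompositions\<close>).

  A fractional matching of a uniform hypergraph with small codegrees can be rounded to a matching of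
  almost the same size (\<open>fractional_matching_rounding\<close>, a theorem of Kahn; for uniform weights it is
  the theorem of Frankl, Roedl and Pippenger). Applied to the hypergraph whose vertices are the edges
  of the complete graph, this yields the packing. The proof is a weighted semi-random method: edges
  are selected at random with probability proportional to a small multiple of their weight, the
  selected edges that meet nothing else that is selected are kept, and the surviving edges, rescaled,
  again carry a fractional matching once the edges at overloaded vertices are discarded. A second
  moment estimate shows that few vertices are overloaded. Only one outcome per bite is
  needed, and the bites are combined by induction on their number, with a growing fraction of the
  total weight that matchings are guaranteed to reach.\<close>

section \<open>Means over random subsets\<close>

text \<open>The mean of \<open>f S\<close> when every \<open>j \<in> J\<close> is put into \<open>S\<close> independently with probability \<open>p j\<close>.
  All means needed below are linear combinations of the probabilities computed in
  \<open>mean_contains_and_avoids\<close>, so a finite weighted sum serves better than a product measure.\<close>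

definition random_subset_mean :: "'b set \<Rightarrow> ('b \<Rightarrow> real) \<Rightarrow> ('b set \<Rightarrow> real) \<Rightarrow> real" where
  "random_subset_mean J p f =
     (\<Sum>S\<in>Pow J. (\<Prod>j\<in>S. p j) * (\<Prod>j\<in>J - S. 1 - p j) * f S)"

lemma mean_add:
  "random_subset_mean J p (\<lambda>S. f S + g S) = random_subset_mean J p f + random_subset_mean J p g"
  by (simp add: random_subset_mean_def distrib_left sum.distrib)

lemma mean_diff:
  "random_subset_mean J p (\<lambda>S. f S - g S) = random_subset_mean J p f - random_subset_mean J p g"
  by (simp add: random_subset_mean_def right_diff_distrib sum_subtractf)

lemma mean_cmult:
  "random_subset_mean J p (\<lambda>S. c * f S) = c * random_subset_mean J p f"
  by (simp add: random_subset_mean_def sum_distrib_left mult_ac)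

lemma mean_sum:
  "random_subset_mean J p (\<lambda>S. \<Sum>i\<in>I. f i S) = (\<Sum>i\<in>I. random_subset_mean J p (f i))"
  unfolding random_subset_mean_def sum_distrib_left by (rule sum.swap)

lemma mean_mono:
  assumes p: "\<And>j. j \<in> J \<Longrightarrow> 0 \<le> p j \<and> p j \<le> 1"
    and fg: "\<And>S. S \<subseteq> J \<Longrightarrow> f S \<le> g S"
  shows "random_subset_mean J p f \<le> random_subset_mean J p g"
  unfolding random_subset_mean_def
proof (rule sum_mono, rule mult_left_mono)
  fix S assume "S \<in> Pow J"
  then show "f S \<le> g S" "0 \<le> (\<Prod>j\<in>S. p j) * (\<Prod>j\<in>J - S. 1 - p j)"
    using p fg by (auto intro!: mult_nonneg_nonneg prod_nonneg)
qed

text \<open>Expanding \<open>\<Prod>j\<in>J. f j + g j\<close> over all subsets, with \<open>f = p\<close> and \<open>g = 1 - p\<close> except that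
  \<open>f\<close> vanishes on \<open>J0\<close> and \<open>g\<close> vanishes on \<open>J1\<close>, leaves exactly the subsets that occur in the
  event.\<close>

lemma mean_contains_and_avoids:
  assumes J: "finite J" and sub: "J1 \<subseteq> J" "J0 \<subseteq> J" and disj: "J1 \<inter> J0 = {}"
  shows "random_subset_mean J p (\<lambda>S. of_bool (J1 \<subseteq> S \<and> S \<inter> J0 = {})) =
    (\<Prod>j\<in>J1. p j) * (\<Prod>j\<in>J0. 1 - p j)"
proof -
  let ?f = "\<lambda>j. if j \<in> J0 then 0 else p j"
  let ?g = "\<lambda>j. if j \<in> J1 then 0 else 1 - p j"
  have fin: "finite S" if "S \<subseteq> J" for S
    using J that by (rule finite_subset[rotated])
  have "random_subset_mean J p (\<lambda>S. of_bool (J1 \<subseteq> S \<and> S \<inter> J0 = {})) =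
      (\<Sum>S\<in>Pow J. prod ?f S * prod ?g (J - S))"
    unfolding random_subset_mean_def
  proof (rule sum.cong[OF refl])
    fix S assume "S \<in> Pow J"
    then have S: "S \<subseteq> J" by simp
    show "prod p S * (\<Prod>j\<in>J - S. 1 - p j) * of_bool (J1 \<subseteq> S \<and> S \<inter> J0 = {}) =
        prod ?f S * prod ?g (J - S)"
    proof (cases "J1 \<subseteq> S \<and> S \<inter> J0 = {}")
      case True
      then have "prod ?f S = prod p S" "prod ?g (J - S) = (\<Prod>j\<in>J - S. 1 - p j)"
        by (auto intro!: prod.cong)
      then show ?thesis using True by simp
    next
      case False
      then consider j where "j \<in> J1" "j \<notin> S" | j where "j \<in> S" "j \<in> J0" by blast
      then have "prod ?f S = 0 \<or> prod ?g (J - S) = 0"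
      proof cases
        case 1
        then have "prod ?g (J - S) = 0"
          using J sub by (intro prod_zero) auto
        then show ?thesis ..
      next
        case 2
        then have "prod ?f S = 0"
          using fin[OF S] by (intro prod_zero) auto
        then show ?thesis ..
      qed
      then show ?thesis using False by auto
    qed
  qed
  also have "\<dots> = (\<Prod>j\<in>J. ?f j + ?g j)"
    using J by (rule prod_add[symmetric])
  also have "\<dots> = (\<Prod>j\<in>J. (if j \<in> J1 then p j else 1) * (if j \<in> J0 then 1 - p j else 1))"
    using disj by (intro prod.cong) auto
  also have "\<dots> = (\<Prod>j\<in>J1. p j) * (\<Prod>j\<in>J0. 1 - p j)"
    using J sub by (simp add: prod.distrib prod.If_cases Int_absorb1)
  finally show ?thesis .
qed

lemma mean_const:
  assumes "finite J"
  shows "random_subset_mean J p (\<lambda>S. c) = c"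
  using mean_contains_and_avoids[OF assms, of "{}" "{}" p] mean_cmult[of J p c "\<lambda>S. 1"] by simp

lemma mean_attained:
  assumes J: "finite J" and p: "\<And>j. j \<in> J \<Longrightarrow> 0 \<le> p j \<and> p j \<le> 1"
  shows "\<exists>S\<subseteq>J. random_subset_mean J p f \<le> f S"
proof -
  have "Max (f ` Pow J) \<in> f ` Pow J"
    using J by (intro Max_in) auto
  then obtain S where S: "S \<subseteq> J" "Max (f ` Pow J) = f S" by auto
  have "f S' \<le> f S" if "S' \<subseteq> J" for S'
    using J that by (auto simp flip: S(2))
  then have "random_subset_mean J p f \<le> random_subset_mean J p (\<lambda>_. f S)"
    by (intro mean_mono p)
  then show ?thesis using S(1) mean_const[OF J] by auto
qed

lemma sum_over_UN_le:
  fixes f :: "'b \<Rightarrow> real"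
  assumes "finite I" "\<And>i. i \<in> I \<Longrightarrow> finite (A i)" "\<And>i x. i \<in> I \<Longrightarrow> x \<in> A i \<Longrightarrow> 0 \<le> f x"
  shows "sum f (\<Union>i\<in>I. A i) \<le> (\<Sum>i\<in>I. sum f (A i))"
  using assms
proof (induction I rule: finite_induct)
  case (insert i I)
  have "sum f (\<Union>i\<in>insert i I. A i) \<le> sum f (A i) + sum f (\<Union>i\<in>I. A i)"
    using insert by (subst UN_insert, subst sum_Un) (auto intro!: sum_nonneg)
  also have "sum f (\<Union>i\<in>I. A i) \<le> (\<Sum>i\<in>I. sum f (A i))"
    using insert by (intro insert.IH) auto
  finally show ?case using insert by simp
qed simp

lemma one_minus_sum_le_prod:
  fixes x :: "'b \<Rightarrow> real"
  assumes "finite J" "\<And>j. j \<in> J \<Longrightarrow> 0 \<le> x j \<and> x j \<le> 1"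
  shows "1 - (\<Sum>j\<in>J. x j) \<le> (\<Prod>j\<in>J. 1 - x j)"
  using assms
proof (induction J rule: finite_induct)
  case (insert i J)
  have le1: "(\<Prod>j\<in>J. 1 - x j) \<le> 1" using insert by (intro prod_le_1) auto
  have "1 - (\<Sum>j\<in>J. x j) \<le> (\<Prod>j\<in>J. 1 - x j)" using insert by auto
  moreover have "x i * (\<Prod>j\<in>J. 1 - x j) \<le> x i * 1"
    using insert le1 by (intro mult_left_mono) auto
  ultimately show ?case using insert by (simp add: algebra_simps)
qed simp

section \<open>Survival of vertices\<close>

text \<open>The probability that no selected set meets \<open>U\<close>, when every \<open>B \<in> J\<close> is selected independently
  with probability \<open>p B\<close>.\<close>

definition surv_prob :: "'a set set \<Rightarrow> ('a set \<Rightarrow> real) \<Rightarrow> 'a set \<Rightarrow> real" where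
  "surv_prob J p U = (\<Prod>B\<in>{B\<in>J. B \<inter> U \<noteq> {}}. 1 - p B)"

definition survives :: "'a set set \<Rightarrow> 'a set \<Rightarrow> bool" where
  "survives S U \<longleftrightarrow> (\<forall>B\<in>S. B \<inter> U = {})"

lemma survives_Un: "survives S (U \<union> W) \<longleftrightarrow> survives S U \<and> survives S W"
  by (auto simp: survives_def)

lemma mean_survives:
  assumes "finite J"
  shows "random_subset_mean J p (\<lambda>S. of_bool (survives S U)) = surv_prob J p U"
proof -
  have "random_subset_mean J p (\<lambda>S. of_bool (survives S U)) =
    random_subset_mean J p (\<lambda>S. of_bool ({} \<subseteq> S \<and> S \<inter> {B\<in>J. B \<inter> U \<noteq> {}} = {}))"
    unfolding random_subset_mean_def survives_def
    by (rule sum.cong[OF refl]) (auto intro!: arg_cong[where f = of_bool])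
  also have "\<dots> = surv_prob J p U"
    unfolding surv_prob_def by (subst mean_contains_and_avoids) (use assms in auto)
  finally show ?thesis .
qed

text \<open>The sets that meet both \<open>u\<close> and \<open>U\<close> measure the dependence between the survival of \<open>u\<close> and of
  \<open>U\<close>: they are counted twice on the right.\<close>

lemma surv_prob_insert:
  assumes J: "finite J"
  shows "surv_prob J p (insert u U) * (\<Prod>B\<in>{B\<in>J. u \<in> B \<and> B \<inter> U \<noteq> {}}. 1 - p B) =
    surv_prob J p {u} * surv_prob J p U"
proof -
  have *: "{B\<in>J. B \<inter> insert u U \<noteq> {}} = {B\<in>J. B \<inter> {u} \<noteq> {}} \<union> {B\<in>J. B \<inter> U \<noteq> {}}"
    "{B\<in>J. u \<in> B \<and> B \<inter> U \<noteq> {}} = {B\<in>J. B \<inter> {u} \<noteq> {}} \<inter> {B\<in>J. B \<inter> U \<noteq> {}}" by auto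
  show ?thesis unfolding surv_prob_def * by (rule prod.union_inter) (use J in auto)
qed

lemma surv_prob_nonneg:
  assumes "\<And>B. B \<in> J \<Longrightarrow> 0 \<le> p B \<and> p B \<le> 1"
  shows "0 \<le> surv_prob J p U"
  unfolding surv_prob_def using assms by (intro prod_nonneg) auto

lemma surv_prob_le_1:
  assumes "\<And>B. B \<in> J \<Longrightarrow> 0 \<le> p B \<and> p B \<le> 1"
  shows "surv_prob J p U \<le> 1"
  unfolding surv_prob_def using assms by (intro prod_le_1) auto

text \<open>Survival is positively correlated: a set that meets several vertices of \<open>U\<close> counts only once
  for the survival of \<open>U\<close>, but several times in the product over its vertices.\<close>

lemma surv_prob_lower:
  assumes J: "finite J" and p: "\<And>B. B \<in> J \<Longrightarrow> 0 \<le> p B \<and> p B \<le> 1"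
    and "finite U" and s: "0 \<le> s" "\<And>u. u \<in> U \<Longrightarrow> surv_prob J p {u} = s"
  shows "s ^ card U \<le> surv_prob J p U"
  using \<open>finite U\<close> s
proof (induction U rule: finite_induct)
  case (insert u U)
  have "s ^ card U \<le> surv_prob J p U" using insert by auto
  then have "s ^ card (insert u U) \<le> surv_prob J p {u} * surv_prob J p U"
    using insert by (simp add: mult_left_mono)
  also have "\<dots> = surv_prob J p (insert u U) * (\<Prod>B\<in>{B\<in>J. u \<in> B \<and> B \<inter> U \<noteq> {}}. 1 - p B)"
    by (rule surv_prob_insert[OF J, symmetric])
  also have "\<dots> \<le> surv_prob J p (insert u U) * 1"
    using p surv_prob_nonneg[OF p] by (intro mult_left_mono prod_le_1) auto
  finally show ?case by simp
qed (simp add: surv_prob_def)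

text \<open>Small codegrees make the survival of a bounded number of vertices nearly independent: adding one
  vertex costs a factor of at most \<open>1 / (1 - m d)\<close>, by the union bound over the sets that join
  it to the earlier vertices.\<close>

lemma surv_prob_upper:
  assumes J: "finite J" and p: "\<And>B. B \<in> J \<Longrightarrow> 0 \<le> p B \<and> p B \<le> 1"
    and "finite U" and s: "0 \<le> s" "\<And>u. u \<in> U \<Longrightarrow> surv_prob J p {u} = s"
    and codeg: "\<And>u v. u \<in> U \<Longrightarrow> v \<in> U \<Longrightarrow> u \<noteq> v \<Longrightarrow> (\<Sum>B\<in>{B\<in>J. u \<in> B \<and> v \<in> B}. p B) \<le> d"
    and d: "0 \<le> d" "real m * d \<le> 1" and m: "card U \<le> m"
  shows "surv_prob J p U * (1 - real m * d) ^ card U \<le> s ^ card U"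
  using \<open>finite U\<close> s codeg m
proof (induction U rule: finite_induct)
  case (insert u U)
  let ?q = "1 - real m * d"
  let ?H = "{B\<in>J. u \<in> B \<and> B \<inter> U \<noteq> {}}"
  have IH: "surv_prob J p U * ?q ^ card U \<le> s ^ card U"
    using insert by auto
  have "(\<Sum>B\<in>?H. p B) \<le> (\<Sum>B\<in>(\<Union>v\<in>U. {B\<in>J. u \<in> B \<and> v \<in> B}). p B)"
    using J p insert.hyps by (intro sum_mono2) auto
  also have "\<dots> \<le> (\<Sum>v\<in>U. \<Sum>B\<in>{B\<in>J. u \<in> B \<and> v \<in> B}. p B)"
    using J p insert.hyps by (intro sum_over_UN_le) auto
  also have "\<dots> \<le> (\<Sum>v\<in>U. d)" using insert by (intro sum_mono) auto
  also have "\<dots> \<le> real m * d" using insert d by (auto intro!: mult_right_mono)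
  finally have "?q \<le> 1 - (\<Sum>B\<in>?H. p B)" by simp
  also have "\<dots> \<le> (\<Prod>B\<in>?H. 1 - p B)" using J p by (intro one_minus_sum_le_prod) auto
  finally have q: "?q \<le> (\<Prod>B\<in>?H. 1 - p B)" .
  have "surv_prob J p (insert u U) * ?q \<le> surv_prob J p {u} * surv_prob J p U"
    unfolding surv_prob_insert[OF J, symmetric]
    using q surv_prob_nonneg[OF p] by (intro mult_left_mono) auto
  then have "surv_prob J p (insert u U) * ?q * ?q ^ card U \<le> s * surv_prob J p U * ?q ^ card U"
    using insert d by (intro mult_right_mono) auto
  also have "\<dots> \<le> s * s ^ card U" 
    using IH insert by (simp add: mult.assoc mult_left_mono)
  finally show ?case using insert by (simp add: mult_ac)
qed (simp add: surv_prob_def)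

section \<open>One bite of a weighted nibble\<close>

text \<open>The weights are bounded from above at every vertex and every pair of vertices, but only their
  total is compared with the size of a matching. In this form the notion is stable under a
  random bite: all edges at an overloaded vertex can simply be discarded, which near-regularity of
  the degrees would not tolerate.\<close>

definition fractional_matching ::
  "nat \<Rightarrow> real \<Rightarrow> 'a set \<Rightarrow> 'a set set \<Rightarrow> ('a set \<Rightarrow> real) \<Rightarrow> bool" where
  "fractional_matching r d V E w \<longleftrightarrow> finite V \<and>
     (\<forall>A\<in>E. A \<subseteq> V \<and> card A = r \<and> 0 \<le> w A) \<and>
     (\<forall>v\<in>V. (\<Sum>A\<in>{A\<in>E. v \<in> A}. w A) \<le> 1) \<and>
     (\<forall>u\<in>V. \<forall>v\<in>V. u \<noteq> v \<longrightarrow> (\<Sum>A\<in>{A\<in>E. u \<in> A \<and> v \<in> A}. w A) \<le> d)"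

lemma fractional_matching_mono:
  assumes "fractional_matching r d V E w" "d \<le> d'"
  shows "fractional_matching r d' V E w"
  using assms unfolding fractional_matching_def by (meson order_trans)

lemma fractional_matching_weight_le:
  assumes frac: "fractional_matching r d V E w" and r: "0 < r"
  shows "(\<Sum>A\<in>E. w A) \<le> real (card V)"
proof -
  have V: "finite V" and w: "\<And>A. A \<in> E \<Longrightarrow> A \<subseteq> V \<and> card A = r \<and> 0 \<le> w A"
    and deg: "\<And>v. v \<in> V \<Longrightarrow> (\<Sum>A\<in>{A\<in>E. v \<in> A}. w A) \<le> 1"
    using frac by (auto simp: fractional_matching_def)
  have E: "finite E" by (rule finite_subset[of _ "Pow V"]) (use w V in auto)
  have "E \<subseteq> (\<Union>v\<in>V. {A\<in>E. v \<in> A})"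
  proof
    fix A assume A: "A \<in> E"
    then have "A \<noteq> {}" using w r by fastforce
    then show "A \<in> (\<Union>v\<in>V. {A\<in>E. v \<in> A})" using w A by blast
  qed
  then have "(\<Sum>A\<in>E. w A) \<le> (\<Sum>A\<in>(\<Union>v\<in>V. {A\<in>E. v \<in> A}). w A)"
    using E V w by (intro sum_mono2) auto
  also have "\<dots> \<le> (\<Sum>v\<in>V. \<Sum>A\<in>{A\<in>E. v \<in> A}. w A)"
    using E V w by (intro sum_over_UN_le) auto
  also have "\<dots> \<le> (\<Sum>v\<in>V. 1)"
    using deg by (intro sum_mono)
  finally show ?thesis by simp
qed

text \<open>One bite: every edge \<open>A\<close> is selected with probability \<open>\<theta> * w A\<close>. In addition every single vertex
  is selected with the probability that makes each vertex avoid all selected sets with probability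
  exactly \<open>1 - \<theta>\<close>; without this correction, edges at vertices of small total weight would survive
  too often, and rescaling the surviving weights by a common factor would overload other vertices.
  The edges have at least two vertices, so these singletons are not edges.\<close>

locale nibble_bite =
  fixes r :: nat and \<delta> \<theta> :: real and V :: "'a set" and E :: "'a set set" and w :: "'a set \<Rightarrow> real"
  assumes frac: "fractional_matching r \<delta> V E w"
    and r2: "2 \<le> r"
    and \<theta>: "0 < \<theta>" "\<theta> < 1"
    and \<delta>: "0 \<le> \<delta>" "8 * real r ^ 2 * \<delta> \<le> 1"
begin

definition s :: real where "s = 1 - \<theta>"

text \<open>The factor that compensates for the loss of surviving edges at a surviving vertex \<open>v\<close>: an edge
  at \<open>v\<close> has \<open>r - 1\<close> further vertices, which survive almost independently.\<close>

definition a :: real where "a = 1 / s ^ (r - 1)"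

text \<open>The sets that may be selected, and their probabilities \<open>p\<close>; the denominator in \<open>p\<close> is the
  probability that no selected edge covers the vertex.\<close>

definition J :: "'a set set" where "J = E \<union> (\<lambda>v. {v}) ` V"

definition p :: "'a set \<Rightarrow> real" where
  "p B = (if B \<in> E then \<theta> * w B
          else 1 - s / (\<Prod>A\<in>{A\<in>E. the_elem B \<in> A}. 1 - \<theta> * w A))"

lemma s_bounds: "0 < s" "s < 1"
  using \<theta> by (auto simp: s_def)

lemma a_ge_1: "1 \<le> a"
  using s_bounds unfolding a_def by (simp add: power_le_one)

lemma a_mult_pow: "a * s ^ r = s"
proof -
  have "s ^ r = s * s ^ (r - 1)"
    using r2 by (cases r) auto
  then show ?thesis using s_bounds by (simp add: a_def)
qed

lemma finV: "finite V" and EV: "A \<in> E \<Longrightarrow> A \<subseteq> V" and Ecard: "A \<in> E \<Longrightarrow> card A = r"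
  and w_nonneg: "A \<in> E \<Longrightarrow> 0 \<le> w A"
  and degree_le: "v \<in> V \<Longrightarrow> (\<Sum>A\<in>{A\<in>E. v \<in> A}. w A) \<le> 1"
  and codegree_le: "u \<in> V \<Longrightarrow> v \<in> V \<Longrightarrow> u \<noteq> v \<Longrightarrow> (\<Sum>A\<in>{A\<in>E. u \<in> A \<and> v \<in> A}. w A) \<le> \<delta>"
  using frac by (auto simp: fractional_matching_def)

lemma finE: "finite E"
  using finV EV by (meson Pow_iff finite_Pow_iff finite_subset subsetI)

lemma finJ: "finite J"
  using finE finV by (simp add: J_def)

lemma finA: "A \<in> E \<Longrightarrow> finite A"
  using EV finV finite_subset by blast

lemma nonemptyA: "A \<in> E \<Longrightarrow> A \<noteq> {}"
  using Ecard r2 by fastforce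

lemma singleton_notin_E: "{v} \<notin> E"
  using Ecard r2 by fastforce

lemma w_le_1: assumes "A \<in> E" shows "w A \<le> 1"
proof -
  obtain v where v: "v \<in> A" using nonemptyA[OF assms] by blast
  have "w A \<le> (\<Sum>A\<in>{A\<in>E. v \<in> A}. w A)"
    using v assms finE w_nonneg by (intro member_le_sum) auto
  also have "\<dots> \<le> 1" using v EV assms by (intro degree_le) auto
  finally show ?thesis .
qed

lemma uncovered_ge: 
  assumes "v \<in> V" shows "s \<le> (\<Prod>A\<in>{A\<in>E. v \<in> A}. 1 - \<theta> * w A)"
proof -
  have "\<theta> * (\<Sum>A\<in>{A\<in>E. v \<in> A}. w A) \<le> \<theta>"
    using degree_le[OF assms] \<theta> by simp
  then have "s \<le> 1 - (\<Sum>A\<in>{A\<in>E. v \<in> A}. \<theta> * w A)"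
    by (simp add: s_def sum_distrib_left)
  also have "\<dots> \<le> (\<Prod>A\<in>{A\<in>E. v \<in> A}. 1 - \<theta> * w A)"
    using \<theta> w_nonneg w_le_1 finE by (intro one_minus_sum_le_prod) (auto simp: mult_le_one)
  finally show ?thesis .
qed

lemma p_bounds: assumes "B \<in> J" shows "0 \<le> p B \<and> p B \<le> 1"
proof (cases "B \<in> E")
  case True
  then show ?thesis using \<theta> w_nonneg w_le_1 by (auto simp: p_def mult_le_one)
next
  case False
  then obtain v where v: "v \<in> V" "B = {v}" using assms by (auto simp: J_def)
  then show ?thesis using uncovered_ge[OF v(1)] s_bounds False
    by (simp add: p_def)
qed

lemma p_E: "A \<in> E \<Longrightarrow> p A = \<theta> * w A" by (simp add: p_def)

lemma surv_prob_vertex: assumes "v \<in> V" shows "surv_prob J p {v} = s"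
proof -
  have *: "{B\<in>J. B \<inter> {v} \<noteq> {}} = insert {v} {A\<in>E. v \<in> A}"
    using assms by (auto simp: J_def)
  define P where "P = (\<Prod>A\<in>{A\<in>E. v \<in> A}. 1 - \<theta> * w A)"
  have "P > 0" using uncovered_ge[OF assms] s_bounds by (simp add: P_def)
  moreover have "(\<Prod>A\<in>{A\<in>E. v \<in> A}. 1 - p A) = P"
    unfolding P_def by (intro prod.cong) (auto simp: p_E)
  moreover have "1 - p {v} = s / P"
    using singleton_notin_E by (simp add: p_def P_def)
  ultimately show ?thesis
    unfolding surv_prob_def * using finE singleton_notin_E by simp
qed

lemma surv_prob_ge: assumes "U \<subseteq> V" shows "s ^ card U \<le> surv_prob J p U"
  using assms s_bounds surv_prob_vertex
  by (intro surv_prob_lower finJ p_bounds finite_subset[OF _ finV]) auto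

lemma surv_prob_le:
  assumes U: "U \<subseteq> V" "card U \<le> 2 * r"
  shows "surv_prob J p U \<le> s ^ card U * (1 + 8 * real r ^ 2 * \<delta>)"
proof -
  let ?q = "1 - real (2 * r) * \<delta>" and ?x = "4 * real r ^ 2 * \<delta>"
  have "2 * real r \<le> 8 * real r ^ 2"
    using r2 by (simp add: power2_eq_square)
  then have "real (2 * r) * \<delta> \<le> 8 * real r ^ 2 * \<delta>"
    using \<delta> by (intro mult_right_mono) auto
  also note \<delta>(2)
  finally have small: "real (2 * r) * \<delta> \<le> 1" .
  have 1: "surv_prob J p U * ?q ^ card U \<le> s ^ card U"
  proof (rule surv_prob_upper[OF finJ p_bounds])
    fix u v assume uv: "u \<in> U" "v \<in> U" "u \<noteq> v"
    then have "{B\<in>J. u \<in> B \<and> v \<in> B} = {A\<in>E. u \<in> A \<and> v \<in> A}" by (auto simp: J_def)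
    then have "(\<Sum>B\<in>{B\<in>J. u \<in> B \<and> v \<in> B}. p B) = \<theta> * (\<Sum>A\<in>{A\<in>E. u \<in> A \<and> v \<in> A}. w A)"
      by (simp add: p_E sum_distrib_left)
    also have "\<dots> \<le> 1 * \<delta>"
      using \<theta> codegree_le[of u v] uv U w_nonneg by (intro mult_mono sum_nonneg) auto
    finally show "(\<Sum>B\<in>{B\<in>J. u \<in> B \<and> v \<in> B}. p B) \<le> \<delta>" by simp
  qed (use U s_bounds surv_prob_vertex \<delta> small finite_subset[OF _ finV] in auto)
  have "1 - ?x \<le> ?q ^ (2 * r)"
    using Bernoulli_inequality[of "- (real (2 * r) * \<delta>)" "2 * r"] small
    by (simp add: power2_eq_square mult_ac)
  also have "\<dots> \<le> ?q ^ card U"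
    using U(2) small \<delta> by (intro power_decreasing) auto
  finally have "surv_prob J p U * (1 - ?x) \<le> surv_prob J p U * ?q ^ card U"
    using surv_prob_nonneg[OF p_bounds] by (intro mult_left_mono) auto
  also note 1
  finally have 2: "surv_prob J p U * (1 - ?x) \<le> s ^ card U" .
  have x: "0 \<le> ?x" "2 * ?x \<le> 1" using \<delta> by auto
  then have "1 \<le> (1 - ?x) * (1 + 2 * ?x)"
    using mult_nonneg_nonneg[of ?x "1 - 2 * ?x"] by (simp add: algebra_simps)
  then have "surv_prob J p U * 1 \<le> surv_prob J p U * ((1 - ?x) * (1 + 2 * ?x))"
    using surv_prob_nonneg[OF p_bounds] by (intro mult_left_mono) auto
  also have "\<dots> = surv_prob J p U * (1 - ?x) * (1 + 2 * ?x)" by simp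
  also have "\<dots> \<le> s ^ card U * (1 + 2 * ?x)"
    using 2 x by (intro mult_right_mono) auto
  finally show ?thesis by (simp add: mult.assoc)
qed

text \<open>How much the rescaled surviving weight at \<open>v\<close> exceeds the old weight at \<open>v\<close>, if \<open>v\<close> survives. If
  \<open>v\<close> does not survive, all terms are zero. The point of the bite is that this is small in mean
  square.\<close>

definition excess :: "'a \<Rightarrow> 'a set set \<Rightarrow> real" where
  "excess v S = (\<Sum>A\<in>{A\<in>E. v \<in> A}.
     w A * (a * of_bool (survives S A) - of_bool (survives S {v})))"

text \<open>The product of two terms of the excess has mean near \<open>0\<close> when the edges share only \<open>v\<close>, since then
  \<open>A \<union> B\<close> has \<open>2 r - 1\<close> vertices and the four terms of the expanded product, two of each sign, all
  have means near \<open>s\<close> or \<open>- s\<close>. The remaining pairs are rare by the codegree bound, so a crude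
  estimate suffices for them.\<close>

lemma mean_excess_product:
  assumes "A \<in> E" "B \<in> E" "v \<in> A" "v \<in> B"
  shows "random_subset_mean J p (\<lambda>S.
      (a * of_bool (survives S A) - of_bool (survives S {v})) *
      (a * of_bool (survives S B) - of_bool (survives S {v})))
    \<le> 8 * real r ^ 2 * \<delta> + a\<^sup>2 * of_bool (A \<inter> B \<noteq> {v})" (is "?L \<le> _")
proof -
  have "(a * of_bool (survives S A) - of_bool (survives S {v})) *
      (a * of_bool (survives S B) - of_bool (survives S {v})) =
      a\<^sup>2 * of_bool (survives S (A \<union> B)) - a * of_bool (survives S A)
        - a * of_bool (survives S B) + of_bool (survives S {v})" for S
  proof -
    have "survives S {v}" if "survives S A \<or> survives S B"
      using that assms unfolding survives_def by blast
    then show ?thesis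
      by (auto simp: survives_Un power2_eq_square algebra_simps of_bool_def)
  qed
  then have "?L = a\<^sup>2 * surv_prob J p (A \<union> B) - a * surv_prob J p A - a * surv_prob J p B
      + surv_prob J p {v}"
    by (simp add: mean_add mean_diff mean_cmult mean_survives[OF finJ])
  also have "surv_prob J p {v} = s"
    using assms EV surv_prob_vertex by auto
  finally have L: "?L = a\<^sup>2 * surv_prob J p (A \<union> B) - a * surv_prob J p A - a * surv_prob J p B + s" .
  have single: "s \<le> a * surv_prob J p C" if "C \<in> E" for C
  proof -
    have "a * s ^ r \<le> a * surv_prob J p C"
      using surv_prob_ge[OF EV[OF that]] Ecard[OF that] a_ge_1 by simp
    then show ?thesis by (simp add: a_mult_pow)
  qed
  show ?thesis
  proof (cases "A \<inter> B = {v}")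
    case True
    have c: "Suc (card (A \<union> B)) = 2 * r"
      using card_Un_Int[of A B] finA Ecard assms True by simp
    have "surv_prob J p (A \<union> B) \<le> s ^ card (A \<union> B) * (1 + 8 * real r ^ 2 * \<delta>)"
      using assms EV c by (intro surv_prob_le) auto
    then have "a\<^sup>2 * surv_prob J p (A \<union> B) \<le> a\<^sup>2 * s ^ card (A \<union> B) * (1 + 8 * real r ^ 2 * \<delta>)"
      by (simp add: mult.assoc mult_left_mono)
    also have "a\<^sup>2 * s ^ card (A \<union> B) = s"
    proof -
      have "s * (a\<^sup>2 * s ^ card (A \<union> B)) = a\<^sup>2 * s ^ Suc (card (A \<union> B))" by simp
      also have "\<dots> = (a * s ^ r)\<^sup>2"
        unfolding c by (simp add: power_mult_distrib power_mult mult.commute flip: power_mult)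
      also have "\<dots> = s * s" by (simp add: a_mult_pow power2_eq_square)
      finally show ?thesis using s_bounds by simp
    qed
    finally have "?L \<le> s * (8 * real r ^ 2 * \<delta>)"
      using L single[OF assms(1)] single[OF assms(2)] by (simp add: algebra_simps)
    also have "\<dots> \<le> 1 * (8 * real r ^ 2 * \<delta>)"
      using s_bounds \<delta> by (intro mult_right_mono) auto
    finally show ?thesis using True by simp
  next
    case False
    have "a\<^sup>2 * surv_prob J p (A \<union> B) \<le> a\<^sup>2 * 1"
      by (intro mult_left_mono surv_prob_le_1 p_bounds) auto
    then have "?L \<le> a\<^sup>2"
      using L single[OF assms(1)] single[OF assms(2)] s_bounds by simp
    moreover have "0 \<le> 8 * real r ^ 2 * \<delta>" using \<delta>(1) by simp
    moreover have "a\<^sup>2 * of_bool (A \<inter> B \<noteq> {v}) = a\<^sup>2" using False by simp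
    ultimately show ?thesis by linarith
  qed
qed

lemma mean_excess_square:
  assumes v: "v \<in> V"
  shows "random_subset_mean J p (\<lambda>S. (excess v S)\<^sup>2) \<le> (8 * real r ^ 2 + real r * a\<^sup>2) * \<delta>"
proof -
  let ?N = "{A\<in>E. v \<in> A}"
  let ?x = "\<lambda>A S. a * of_bool (survives S A) - of_bool (survives S {v})"
  have "(excess v S)\<^sup>2 = (\<Sum>A\<in>?N. \<Sum>B\<in>?N. (w A * w B) * (?x A S * ?x B S))" for S
    unfolding excess_def power2_eq_square sum_product by (simp add: mult_ac)
  then have "random_subset_mean J p (\<lambda>S. (excess v S)\<^sup>2) =
      (\<Sum>A\<in>?N. \<Sum>B\<in>?N. (w A * w B) * random_subset_mean J p (\<lambda>S. ?x A S * ?x B S))"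
    by (simp only: mean_sum mean_cmult)
  also have "\<dots> \<le> (\<Sum>A\<in>?N. \<Sum>B\<in>?N.
      (w A * w B) * (8 * real r ^ 2 * \<delta> + a\<^sup>2 * of_bool (A \<inter> B \<noteq> {v})))"
    using w_nonneg by (intro sum_mono mult_left_mono mean_excess_product) auto
  also have "\<dots> = (\<Sum>A\<in>?N. w A * (8 * real r ^ 2 * \<delta> * (\<Sum>B\<in>?N. w B)
      + a\<^sup>2 * (\<Sum>B\<in>?N. w B * of_bool (A \<inter> B \<noteq> {v}))))"
    by (simp add: sum_distrib_left distrib_left sum.distrib mult_ac)
  also have "\<dots> \<le> (\<Sum>A\<in>?N. w A * (8 * real r ^ 2 * \<delta> * 1 + a\<^sup>2 * (real r * \<delta>)))"
  proof (intro sum_mono mult_left_mono add_mono)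
    fix A assume A: "A \<in> ?N"
    show "0 \<le> w A" using A w_nonneg by simp
    show "(\<Sum>B\<in>?N. w B) \<le> 1" using degree_le[OF v] .
    have "(\<Sum>B\<in>?N. w B * of_bool (A \<inter> B \<noteq> {v})) = (\<Sum>B\<in>{B\<in>?N. A \<inter> B \<noteq> {v}}. w B)"
      using finE by (intro sum.mono_neutral_cong_right) auto
    also have "\<dots> \<le> (\<Sum>B\<in>(\<Union>u\<in>A - {v}. {B\<in>E. v \<in> B \<and> u \<in> B}). w B)"
      using A finE finA w_nonneg by (intro sum_mono2) auto
    also have "\<dots> \<le> (\<Sum>u\<in>A - {v}. \<Sum>B\<in>{B\<in>E. v \<in> B \<and> u \<in> B}. w B)"
      using A finE finA w_nonneg by (intro sum_over_UN_le) auto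
    also have "\<dots> \<le> (\<Sum>u\<in>A - {v}. \<delta>)"
      using A v EV by (intro sum_mono codegree_le) auto
    also have "\<dots> \<le> real r * \<delta>"
      using A finA Ecard \<delta> by (auto intro!: mult_right_mono)
    finally show "(\<Sum>B\<in>?N. w B * of_bool (A \<inter> B \<noteq> {v})) \<le> real r * \<delta>" .
  qed (use \<delta> in auto)
  also have "\<dots> = (\<Sum>A\<in>?N. w A) * ((8 * real r ^ 2 + real r * a\<^sup>2) * \<delta>)"
    by (subst sum_distrib_right) (intro sum.cong refl, simp add: algebra_simps)
  also have "\<dots> \<le> 1 * ((8 * real r ^ 2 + real r * a\<^sup>2) * \<delta>)"
    using degree_le[OF v] \<delta> by (intro mult_right_mono) auto
  finally show ?thesis by simp
qed

text \<open>What this bite contributes to the matching.\<close>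

definition isolated :: "'a set set \<Rightarrow> 'a set set" where
  "isolated S = {A\<in>E. A \<in> S \<and> (\<forall>B\<in>S - {A}. B \<inter> A = {})}"

text \<open>What is passed on to the next bite. Bounding the excess keeps the rescaled weight at every vertex
  at most \<open>1 + \<tau>\<close>.\<close>

definition good :: "real \<Rightarrow> 'a set set \<Rightarrow> 'a set set" where
  "good \<tau> S = {A\<in>E. survives S A \<and> (\<forall>v\<in>A. excess v S \<le> \<tau>)}"

lemma mean_card_isolated:
  "\<theta> * s ^ r * (\<Sum>A\<in>E. w A) \<le> random_subset_mean J p (\<lambda>S. real (card (isolated S)))"
proof -
  have "\<theta> * s ^ r * w A \<le> random_subset_mean J p (\<lambda>S. of_bool (A \<in> isolated S))"
    if A: "A \<in> E" for A
  proof -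
    let ?H = "{B\<in>J - {A}. B \<inter> A \<noteq> {}}"
    have "random_subset_mean J p (\<lambda>S. of_bool (A \<in> isolated S)) =
      random_subset_mean J p (\<lambda>S. of_bool ({A} \<subseteq> S \<and> S \<inter> ?H = {}))"
      unfolding random_subset_mean_def isolated_def using A
      by (intro sum.cong[OF refl]) (auto intro!: arg_cong[where f = of_bool])
    also have "\<dots> = p A * (\<Prod>B\<in>?H. 1 - p B)"
      using A finJ by (subst mean_contains_and_avoids) (auto simp: J_def)
    finally have m: "random_subset_mean J p (\<lambda>S. of_bool (A \<in> isolated S)) = p A * (\<Prod>B\<in>?H. 1 - p B)" .
    have "s ^ r \<le> surv_prob J p A"
      using surv_prob_ge[OF EV[OF A]] Ecard[OF A] by simp
    also have "\<dots> = (1 - p A) * (\<Prod>B\<in>?H. 1 - p B)"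
    proof -
      have "{B\<in>J. B \<inter> A \<noteq> {}} = insert A ?H" using A nonemptyA[OF A] by (auto simp: J_def)
      then show ?thesis using finJ by (simp add: surv_prob_def)
    qed
    also have "\<dots> \<le> 1 * (\<Prod>B\<in>?H. 1 - p B)"
      using p_bounds A by (intro mult_right_mono prod_nonneg) (auto simp: J_def)
    finally have "p A * s ^ r \<le> p A * (\<Prod>B\<in>?H. 1 - p B)"
      using p_bounds A by (intro mult_left_mono) (auto simp: J_def)
    then show ?thesis unfolding m p_E[OF A] by (simp add: mult_ac)
  qed
  then have "(\<Sum>A\<in>E. \<theta> * s ^ r * w A) \<le> (\<Sum>A\<in>E. random_subset_mean J p (\<lambda>S. of_bool (A \<in> isolated S)))"
    by (intro sum_mono)
  also have "\<dots> = random_subset_mean J p (\<lambda>S. \<Sum>A\<in>E. of_bool (A \<in> isolated S))"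
    by (simp add: mean_sum)
  also have "\<dots> = random_subset_mean J p (\<lambda>S. real (card (isolated S)))"
  proof -
    have "(\<Sum>A\<in>E. of_bool (A \<in> isolated S)) = real (card (isolated S))" for S
    proof -
      have "{A\<in>E. A \<in> isolated S} = isolated S" by (auto simp: isolated_def)
      then show ?thesis using finE by (simp add: of_bool_def sum.If_cases Int_def)
    qed
    then show ?thesis by simp
  qed
  finally show ?thesis by (simp add: sum_distrib_left)
qed

lemma surviving_degree:
  assumes "v \<in> V"
  shows "(\<Sum>A\<in>{A\<in>E. v \<in> A}. a * w A * of_bool (survives S A)) \<le> excess v S + 1"
proof -
  have "(\<Sum>A\<in>{A\<in>E. v \<in> A}. a * w A * of_bool (survives S A)) =
    excess v S + (\<Sum>A\<in>{A\<in>E. v \<in> A}. w A) * of_bool (survives S {v})"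
    unfolding excess_def sum_distrib_right
    by (simp add: algebra_simps flip: sum.distrib)
  also have "(\<Sum>A\<in>{A\<in>E. v \<in> A}. w A) * of_bool (survives S {v}) \<le> 1 * 1"
    using degree_le[OF assms] by (intro mult_mono) auto
  finally show ?thesis by simp
qed

lemma good_fractional_matching:
  assumes \<tau>: "0 < \<tau>"
  shows "fractional_matching r (a * \<delta>) V (good \<tau> S) (\<lambda>A. a / (1 + \<tau>) * w A)"
  unfolding fractional_matching_def
proof (intro conjI ballI impI)
  fix A assume "A \<in> good \<tau> S"
  then have A: "A \<in> E" by (simp add: good_def)
  then show "A \<subseteq> V" "card A = r" "0 \<le> a / (1 + \<tau>) * w A"
    using EV Ecard w_nonneg a_ge_1 \<tau> by auto
next
  fix v assume v: "v \<in> V"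
  let ?G = "{A\<in>good \<tau> S. v \<in> A}"
  show "(\<Sum>A\<in>?G. a / (1 + \<tau>) * w A) \<le> 1"
  proof (cases "excess v S \<le> \<tau>")
    case True
    have "(\<Sum>A\<in>?G. a * w A) = (\<Sum>A\<in>?G. a * w A * of_bool (survives S A))"
      by (intro sum.cong) (auto simp: good_def)
    also have "\<dots> \<le> (\<Sum>A\<in>{A\<in>E. v \<in> A}. a * w A * of_bool (survives S A))"
      using finE w_nonneg a_ge_1 by (intro sum_mono2) (auto simp: good_def)
    also have "\<dots> \<le> 1 + \<tau>" using surviving_degree[OF v, of S] True by simp
    finally have "(\<Sum>A\<in>?G. a * w A) / (1 + \<tau>) \<le> 1" using \<tau> by simp
    then show ?thesis by (simp add: sum_divide_distrib)
  next
    case False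
    then have "?G = {}" by (auto simp: good_def)
    then show ?thesis by (simp only: sum.empty zero_le_one)
  qed
next
  fix u v assume uv: "u \<in> V" "v \<in> V" "u \<noteq> v"
  have "(\<Sum>A\<in>{A\<in>good \<tau> S. u \<in> A \<and> v \<in> A}. a / (1 + \<tau>) * w A)
     \<le> (\<Sum>A\<in>{A\<in>good \<tau> S. u \<in> A \<and> v \<in> A}. a * w A)"
    using a_ge_1 \<tau> w_nonneg by (intro sum_mono mult_right_mono) (auto simp: good_def field_simps)
  also have "\<dots> \<le> (\<Sum>A\<in>{A\<in>E. u \<in> A \<and> v \<in> A}. a * w A)"
    using a_ge_1 w_nonneg finE by (intro sum_mono2) (auto simp: good_def)
  also have "\<dots> \<le> a * \<delta>"
    using a_ge_1 codegree_le[OF uv] by (simp flip: sum_distrib_left)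
  finally show "(\<Sum>A\<in>{A\<in>good \<tau> S. u \<in> A \<and> v \<in> A}. a / (1 + \<tau>) * w A) \<le> a * \<delta>" .
qed (rule finV)

text \<open>Discarding the edges at overloaded vertices costs little. The surviving weight at such a vertex is
  at most \<open>excess + 1\<close>, and \<open>excess > \<tau>\<close> turns this into a multiple of the square of the
  excess, as in the proof of Chebyshev's inequality.\<close>

lemma good_weight_ge:
  assumes \<tau>: "0 < \<tau>"
  shows "a * (\<Sum>A\<in>E. w A * of_bool (survives S A)) - (1 / \<tau> + 1 / \<tau>\<^sup>2) * (\<Sum>v\<in>V. (excess v S)\<^sup>2)
    \<le> a * (\<Sum>A\<in>good \<tau> S. w A)"
proof -
  let ?x = "\<lambda>A. a * w A * of_bool (survives S A)"
  let ?bad = "{v\<in>V. excess v S > \<tau>}"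
  have "(\<Sum>A\<in>E. ?x A) \<le> (\<Sum>A\<in>good \<tau> S \<union> (\<Union>v\<in>?bad. {A\<in>E. v \<in> A}). ?x A)"
  proof -
    have "(\<Sum>A\<in>E. ?x A) = (\<Sum>A\<in>{A\<in>E. survives S A}. ?x A)"
      using finE by (intro sum.mono_neutral_right) auto
    also have "\<dots> \<le> (\<Sum>A\<in>good \<tau> S \<union> (\<Union>v\<in>?bad. {A\<in>E. v \<in> A}). ?x A)"
    proof (rule sum_mono2)
      show "finite (good \<tau> S \<union> (\<Union>v\<in>?bad. {A\<in>E. v \<in> A}))"
        by (rule finite_subset[OF _ finE]) (auto simp: good_def)
      show "{A\<in>E. survives S A} \<subseteq> good \<tau> S \<union> (\<Union>v\<in>?bad. {A\<in>E. v \<in> A})"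
      proof
        fix A assume A: "A \<in> {A\<in>E. survives S A}"
        show "A \<in> good \<tau> S \<union> (\<Union>v\<in>?bad. {A\<in>E. v \<in> A})"
        proof (cases "\<forall>v\<in>A. excess v S \<le> \<tau>")
          case True
          then show ?thesis using A by (simp add: good_def)
        next
          case False
          then obtain v where "v \<in> A" "excess v S > \<tau>" by auto
          then show ?thesis using A EV by blast
        qed
      qed
      show "0 \<le> ?x A" if "A \<in> good \<tau> S \<union> (\<Union>v\<in>?bad. {A\<in>E. v \<in> A}) - {A\<in>E. survives S A}" for A
        using that w_nonneg[of A] a_ge_1 by (auto simp: good_def)
    qed
    finally show ?thesis .
  qed
  also have "\<dots> \<le> (\<Sum>A\<in>good \<tau> S. ?x A) + (\<Sum>A\<in>(\<Union>v\<in>?bad. {A\<in>E. v \<in> A}). ?x A)"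
    using finE finV w_nonneg a_ge_1
    by (subst sum_Un) (auto simp: good_def intro!: sum_nonneg)
  also have "(\<Sum>A\<in>good \<tau> S. ?x A) = a * (\<Sum>A\<in>good \<tau> S. w A)"
    unfolding sum_distrib_left by (intro sum.cong) (auto simp: good_def)
  also have "(\<Sum>A\<in>(\<Union>v\<in>?bad. {A\<in>E. v \<in> A}). ?x A) \<le> (\<Sum>v\<in>?bad. \<Sum>A\<in>{A\<in>E. v \<in> A}. ?x A)"
    using finE finV w_nonneg a_ge_1 by (intro sum_over_UN_le) auto
  also have "\<dots> \<le> (\<Sum>v\<in>?bad. (1 / \<tau> + 1 / \<tau>\<^sup>2) * (excess v S)\<^sup>2)"
  proof (rule sum_mono)
    fix v assume v: "v \<in> ?bad"
    let ?y = "excess v S / \<tau>"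
    have y: "1 \<le> ?y" using v \<tau> by simp
    have "excess v S + 1 \<le> (\<tau> + 1) * ?y\<^sup>2"
    proof -
      have "excess v S = \<tau> * ?y" using \<tau> by simp
      also have "?y \<le> ?y\<^sup>2" by (rule self_le_power[OF y]) simp
      finally have "excess v S \<le> \<tau> * ?y\<^sup>2" using \<tau> by simp
      moreover have "1 \<le> ?y\<^sup>2" by (rule one_le_power[OF y])
      ultimately have "excess v S + 1 \<le> \<tau> * ?y\<^sup>2 + ?y\<^sup>2" by (rule add_mono)
      then show ?thesis by (simp only: distrib_right mult_1_left)
    qed
    also have "\<dots> = (1 / \<tau> + 1 / \<tau>\<^sup>2) * (excess v S)\<^sup>2"
      using \<tau> by (simp add: field_simps power2_eq_square)
    finally show "(\<Sum>A\<in>{A\<in>E. v \<in> A}. ?x A) \<le> (1 / \<tau> + 1 / \<tau>\<^sup>2) * (excess v S)\<^sup>2"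
      using surviving_degree[of v S] v by auto
  qed
  also have "\<dots> \<le> (\<Sum>v\<in>V. (1 / \<tau> + 1 / \<tau>\<^sup>2) * (excess v S)\<^sup>2)"
    using finV \<tau> by (intro sum_mono2) auto
  finally show ?thesis by (simp add: sum_distrib_left mult_ac)
qed

text \<open>Some outcome does as well as the mean: the isolated edges and \<open>c\<close> times the weight passed on
  amount to the fraction \<open>\<theta> * s ^ r + c * s\<close> of the old weight, up to a small multiple of the number
  of vertices.\<close>

lemma good_outcome:
  assumes \<tau>: "0 < \<tau>" and c: "0 \<le> c" "c \<le> 1"
  shows "\<exists>S\<subseteq>J. (\<theta> * s ^ r + c * s) * (\<Sum>A\<in>E. w A)
      - (\<tau> + (1 / \<tau> + 1 / \<tau>\<^sup>2) * ((8 * real r ^ 2 + real r * a\<^sup>2) * \<delta>)) * real (card V)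
    \<le> real (card (isolated S)) + c * (\<Sum>A\<in>good \<tau> S. a / (1 + \<tau>) * w A)"
proof -
  let ?T = "\<Sum>A\<in>E. w A" and ?L = "1 / \<tau> + 1 / \<tau>\<^sup>2" and ?N = "real (card V)"
  let ?K = "(8 * real r ^ 2 + real r * a\<^sup>2) * \<delta>"
  let ?m = "random_subset_mean J p"
  let ?R = "\<lambda>S. a * (\<Sum>A\<in>E. w A * of_bool (survives S A)) - ?L * (\<Sum>v\<in>V. (excess v S)\<^sup>2)"
  have T0: "0 \<le> ?T" using w_nonneg by (simp add: sum_nonneg)
  have TN: "?T \<le> ?N" using fractional_matching_weight_le[OF frac] r2 by simp
  have LK: "0 \<le> ?L * (?N * ?K)" using \<tau> \<delta> by (intro mult_nonneg_nonneg add_nonneg_nonneg) auto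
  have "s * ?T = a * (\<Sum>A\<in>E. w A * s ^ r)"
    by (simp add: a_mult_pow mult_ac flip: sum_distrib_left sum_distrib_right)
  also have "\<dots> \<le> a * (\<Sum>A\<in>E. w A * surv_prob J p A)"
    using a_ge_1 w_nonneg surv_prob_ge[OF EV] Ecard
    by (intro mult_left_mono sum_mono) auto
  also have "\<dots> = ?m (\<lambda>S. a * (\<Sum>A\<in>E. w A * of_bool (survives S A)))"
    by (simp add: mean_cmult mean_sum mean_survives[OF finJ])
  finally have m1: "s * ?T \<le> ?m (\<lambda>S. a * (\<Sum>A\<in>E. w A * of_bool (survives S A)))" .
  have "?m (\<lambda>S. ?L * (\<Sum>v\<in>V. (excess v S)\<^sup>2)) = ?L * (\<Sum>v\<in>V. ?m (\<lambda>S. (excess v S)\<^sup>2))"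
    by (simp only: mean_cmult mean_sum)
  also have "\<dots> \<le> ?L * (\<Sum>v\<in>V. ?K)"
    using \<tau> mean_excess_square by (intro mult_left_mono sum_mono) auto
  also have "\<dots> = ?L * (?N * ?K)" by simp
  finally have m2: "?m (\<lambda>S. ?L * (\<Sum>v\<in>V. (excess v S)\<^sup>2)) \<le> ?L * (?N * ?K)" .
  have mR: "s * ?T - ?L * (?N * ?K) \<le> ?m ?R"
    using m1 m2 by (simp only: mean_diff)
  have "c / (1 + \<tau>) * (s * ?T - ?L * (?N * ?K)) \<le> c / (1 + \<tau>) * ?m ?R"
    using mR c \<tau> by (intro mult_left_mono) auto
  moreover have "c * s * ?T - \<tau> * ?N \<le> c / (1 + \<tau>) * (s * ?T)"
  proof -
    have "c * s * ?T - c / (1 + \<tau>) * (s * ?T) = (\<tau> / (1 + \<tau>)) * (c * (s * ?T))"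
      using \<tau> by (simp add: field_simps)
    also have "\<dots> \<le> \<tau> * (1 * (1 * ?N))"
      using \<tau> c s_bounds T0 TN
      by (intro mult_mono mult_nonneg_nonneg) (auto simp: field_simps)
    finally show ?thesis by simp
  qed
  moreover have "c / (1 + \<tau>) * (?L * (?N * ?K)) \<le> 1 * (?L * (?N * ?K))"
    using LK c \<tau> by (intro mult_right_mono) auto
  ultimately have "c * s * ?T - \<tau> * ?N - ?L * (?N * ?K) \<le> c / (1 + \<tau>) * ?m ?R"
    by (simp add: right_diff_distrib)
  then have "(\<theta> * s ^ r + c * s) * ?T - (\<tau> + ?L * ?K) * ?N
      \<le> ?m (\<lambda>S. real (card (isolated S))) + c / (1 + \<tau>) * ?m ?R"
    using mean_card_isolated by (simp add: algebra_simps)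
  also have "\<dots> = ?m (\<lambda>S. real (card (isolated S)) + c / (1 + \<tau>) * ?R S)"
    by (simp only: mean_add mean_cmult)
  finally obtain S where S: "S \<subseteq> J"
    "(\<theta> * s ^ r + c * s) * ?T - (\<tau> + ?L * ?K) * ?N \<le> real (card (isolated S)) + c / (1 + \<tau>) * ?R S"
    using mean_attained[OF finJ p_bounds, where f = "\<lambda>S. real (card (isolated S)) + c / (1 + \<tau>) * ?R S"]
    by (meson order_trans)
  have "c / (1 + \<tau>) * ?R S \<le> c / (1 + \<tau>) * (a * (\<Sum>A\<in>good \<tau> S. w A))"
    using good_weight_ge[OF \<tau>, of S] c \<tau> by (intro mult_left_mono) auto
  also have "\<dots> = c * (\<Sum>A\<in>good \<tau> S. a / (1 + \<tau>) * w A)"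
    by (simp add: sum_distrib_left)
  finally show ?thesis using S by (intro exI[of _ S]) simp
qed

lemma isolated_Un_matching:
  assumes M: "M \<subseteq> good \<tau> S" "pairwise disjnt M"
  shows "isolated S \<union> M \<subseteq> E" "pairwise disjnt (isolated S \<union> M)"
    "card (isolated S \<union> M) = card (isolated S) + card M"
proof -
  show sub: "isolated S \<union> M \<subseteq> E" using M by (auto simp: isolated_def good_def)
  have cross: "disjnt A B" if "A \<in> isolated S" "B \<in> M" for A B
    using that M by (force simp: isolated_def good_def survives_def disjnt_def)
  then have "isolated S \<inter> M = {}"
    using sub nonemptyA by (fastforce simp: disjnt_def)
  then show "card (isolated S \<union> M) = card (isolated S) + card M"
    using sub finE by (intro card_Un_disjoint) (auto intro: finite_subset)
  have "disjnt A B" if "A \<in> isolated S" "B \<in> isolated S" "A \<noteq> B" for A B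
    using that unfolding isolated_def disjnt_def by blast
  then show "pairwise disjnt (isolated S \<union> M)"
    using cross M(2) unfolding pairwise_def by (metis Un_iff disjnt_sym)
qed

end

section \<open>Rounding fractional matchings\<close>

text \<open>If integral matchings can reach the fraction \<open>c\<close> of the weight of every fractional matching with
  small codegrees, then they can reach the fraction \<open>\<theta> * (1 - \<theta>) ^ r + c * (1 - \<theta>)\<close>: take the
  isolated edges of one bite and apply the hypothesis to the edges that are passed on.\<close>

lemma matching_ratio_step:
  fixes \<theta> c \<eta> :: real
  assumes r2: "2 \<le> r" and \<theta>: "0 < \<theta>" "\<theta> < 1" and c: "0 \<le> c" "c \<le> 1" and \<eta>: "0 < \<eta>"
    and IH: "\<And>\<eta>::real. 0 < \<eta> \<Longrightarrow> \<exists>d>0. \<forall>(V::'a set) E w. fractional_matching r d V E w \<longrightarrow>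
      (\<exists>M\<subseteq>E. pairwise disjnt M \<and> c * (\<Sum>A\<in>E. w A) - \<eta> * real (card V) \<le> real (card M))"
  shows "\<exists>d>0. \<forall>(V::'a set) E w. fractional_matching r d V E w \<longrightarrow>
    (\<exists>M\<subseteq>E. pairwise disjnt M \<and>
      (\<theta> * (1 - \<theta>) ^ r + c * (1 - \<theta>)) * (\<Sum>A\<in>E. w A) - \<eta> * real (card V) \<le> real (card M))"
proof -
  obtain d' where d': "d' > 0"
    "\<And>(V::'a set) E w. fractional_matching r d' V E w \<Longrightarrow>
      \<exists>M\<subseteq>E. pairwise disjnt M \<and> c * (\<Sum>A\<in>E. w A) - \<eta> / 2 * real (card V) \<le> real (card M)"
    using IH[of "\<eta> / 2"] \<eta> by auto
  define b where "b = 1 / (1 - \<theta>) ^ (r - 1)"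
  \<comment> \<open>The loss \<open>\<eta>\<close> is split: a half for the matching of the good edges, a quarter for \<open>\<tau>\<close>, and a quarter for the excess term \<open>L * \<delta>\<close>.\<close>
  define \<tau> where "\<tau> = \<eta> / 4"
  define L where "L = (1 / \<tau> + 1 / \<tau>\<^sup>2) * (8 * real r ^ 2 + real r * b\<^sup>2)"
  define \<delta> where "\<delta> = min (d' / b) (min (1 / (8 * real r ^ 2)) (\<eta> / (4 * L)))"
  have b: "b > 0" using \<theta> by (simp add: b_def)
  have \<tau>: "0 < \<tau>" using \<eta> by (simp add: \<tau>_def)
  have L: "L > 0" unfolding L_def using \<tau> r2 by (intro mult_pos_pos add_pos_nonneg) auto
  have \<delta>_small: "\<delta> > 0" "b * \<delta> \<le> d'" "8 * real r ^ 2 * \<delta> \<le> 1" "L * \<delta> \<le> \<eta> / 4"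
  proof -
    show "\<delta> > 0" unfolding \<delta>_def using d'(1) b r2 \<eta> L by simp
    have "\<delta> \<le> d' / b" "\<delta> \<le> 1 / (8 * real r ^ 2)" "\<delta> \<le> \<eta> / (4 * L)"
      unfolding \<delta>_def by auto
    then show "b * \<delta> \<le> d'" "8 * real r ^ 2 * \<delta> \<le> 1" "L * \<delta> \<le> \<eta> / 4"
      using b r2 L by (auto simp: field_simps)
  qed
  show ?thesis
  proof (intro exI[of _ \<delta>] conjI allI impI)
    fix V :: "'a set" and E w
    assume frac: "fractional_matching r \<delta> V E w"
    interpret nibble_bite r \<delta> \<theta> V E w
      using frac r2 \<theta> \<delta>_small by unfold_locales auto
    have s_eq: "s = 1 - \<theta>" and a_eq: "a = b"
      by (simp_all add: s_def a_def b_def)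
    note outcome = good_outcome[OF \<tau> c, unfolded a_eq s_eq]
    then obtain S where S: "(\<theta> * (1 - \<theta>) ^ r + c * (1 - \<theta>)) * (\<Sum>A\<in>E. w A)
        - (\<tau> + L * \<delta>) * real (card V)
      \<le> real (card (isolated S)) + c * (\<Sum>A\<in>good \<tau> S. b / (1 + \<tau>) * w A)"
      unfolding L_def by (auto simp: mult.assoc)
    have "fractional_matching r d' V (good \<tau> S) (\<lambda>A. b / (1 + \<tau>) * w A)"
      using good_fractional_matching[OF \<tau>, of S] \<delta>_small(2) unfolding a_eq
      by (rule fractional_matching_mono)
    then obtain M where M: "M \<subseteq> good \<tau> S" "pairwise disjnt M"
      "c * (\<Sum>A\<in>good \<tau> S. b / (1 + \<tau>) * w A) - \<eta> / 2 * real (card V) \<le> real (card M)"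
      using d'(2) by blast
    have "(\<tau> + L * \<delta>) * real (card V) \<le> \<eta> / 2 * real (card V)"
      using \<delta>_small(4) by (intro mult_right_mono) (auto simp: \<tau>_def)
    then have "(\<theta> * (1 - \<theta>) ^ r + c * (1 - \<theta>)) * (\<Sum>A\<in>E. w A) - \<eta> * real (card V)
        \<le> real (card (isolated S \<union> M))"
      using S M(3) isolated_Un_matching(3)[OF M(1,2)] by (simp add: algebra_simps)
    then show "\<exists>M\<subseteq>E. pairwise disjnt M \<and>
      (\<theta> * (1 - \<theta>) ^ r + c * (1 - \<theta>)) * (\<Sum>A\<in>E. w A) - \<eta> * real (card V) \<le> real (card M)"
      using isolated_Un_matching(1,2)[OF M(1,2)] by blast
  qed (rule \<delta>_small(1))
qed

text \<open>Starting from the trivial fraction \<open>0\<close>, the step above produces the fractions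
  \<open>(1 - \<theta>) ^ r * (1 - (1 - \<theta>) ^ t)\<close>, and these come as close to \<open>1\<close> as desired when \<open>\<theta>\<close> is small
  and then \<open>t\<close> is large.\<close>

theorem fractional_matching_rounding:
  fixes \<epsilon> :: real
  assumes r2: "2 \<le> r" and \<epsilon>: "0 < \<epsilon>"
  shows "\<exists>d>0. \<forall>(V::'a set) E w. fractional_matching r d V E w \<longrightarrow>
    (\<exists>M\<subseteq>E. pairwise disjnt M \<and> (\<Sum>A\<in>E. w A) - \<epsilon> * real (card V) \<le> real (card M))"
proof -
  have iter: "\<exists>d>0. \<forall>(V::'a set) E w. fractional_matching r d V E w \<longrightarrow>
      (\<exists>M\<subseteq>E. pairwise disjnt M \<and>
        (1 - \<theta>) ^ r * (1 - (1 - \<theta>) ^ t) * (\<Sum>A\<in>E. w A) - \<eta> * real (card V) \<le> real (card M))"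
    if \<theta>: "0 < \<theta>" "\<theta> < 1" and \<eta>: "0 < \<eta>" for \<theta> \<eta> :: real and t :: nat
    using \<eta>
  proof (induction t arbitrary: \<eta>)
    case 0
    then show ?case by (intro exI[of _ 1]) (auto intro!: exI[of _ "{}"])
  next
    case (Suc t)
    have "(1 - \<theta>) ^ t \<le> 1" using \<theta> by (intro power_le_one) auto
    then have c: "0 \<le> (1 - \<theta>) ^ r * (1 - (1 - \<theta>) ^ t)" "(1 - \<theta>) ^ r * (1 - (1 - \<theta>) ^ t) \<le> 1"
      using \<theta> by (auto intro!: mult_le_one power_le_one)
    have "\<theta> * (1 - \<theta>) ^ r + (1 - \<theta>) ^ r * (1 - (1 - \<theta>) ^ t) * (1 - \<theta>) =
        (1 - \<theta>) ^ r * (1 - (1 - \<theta>) ^ Suc t)"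
      by (simp add: algebra_simps)
    then show ?case
      using matching_ratio_step[OF r2 \<theta> c Suc.prems Suc.IH] by simp
  qed
  define \<theta> where "\<theta> = min (1 / 2) (\<epsilon> / (4 * real r))"
  have \<theta>: "0 < \<theta>" "\<theta> < 1" "real r * \<theta> \<le> \<epsilon> / 4"
  proof -
    show "0 < \<theta>" "\<theta> < 1" using \<epsilon> r2 by (auto simp: \<theta>_def)
    have "\<theta> \<le> \<epsilon> / (4 * real r)" by (simp add: \<theta>_def)
    then show "real r * \<theta> \<le> \<epsilon> / 4" using r2 by (simp add: field_simps)
  qed
  obtain t where t: "(1 - \<theta>) ^ t < \<epsilon> / 4"
    using real_arch_pow_inv[of "\<epsilon> / 4" "1 - \<theta>"] \<epsilon> \<theta> by auto
  let ?c = "(1 - \<theta>) ^ r * (1 - (1 - \<theta>) ^ t)"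
  have c: "1 - \<epsilon> / 2 \<le> ?c"
  proof -
    have "1 - \<epsilon> / 4 \<le> (1 - \<theta>) ^ r"
      using Bernoulli_inequality[of "- \<theta>" r] \<theta> by simp
    moreover have "(1 - \<theta>) ^ r * (1 - \<theta>) ^ t \<le> 1 * (1 - \<theta>) ^ t"
      using \<theta> by (intro mult_right_mono power_le_one) auto
    ultimately show ?thesis using t by (simp add: algebra_simps)
  qed
  obtain d where d: "d > 0" "\<And>(V::'a set) E w. fractional_matching r d V E w \<Longrightarrow>
      \<exists>M\<subseteq>E. pairwise disjnt M \<and> ?c * (\<Sum>A\<in>E. w A) - \<epsilon> / 2 * real (card V) \<le> real (card M)"
    using iter[OF \<theta>(1,2), of "\<epsilon> / 2" t] \<epsilon> by auto
  show ?thesis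
  proof (intro exI[of _ d] conjI allI impI)
    fix V :: "'a set" and E w
    assume frac: "fractional_matching r d V E w"
    then obtain M where M: "M \<subseteq> E" "pairwise disjnt M"
      "?c * (\<Sum>A\<in>E. w A) - \<epsilon> / 2 * real (card V) \<le> real (card M)"
      using d(2) by blast
    have T0: "0 \<le> (\<Sum>A\<in>E. w A)"
      using frac by (auto simp: fractional_matching_def intro!: sum_nonneg)
    have TN: "(\<Sum>A\<in>E. w A) \<le> real (card V)"
      using fractional_matching_weight_le[OF frac] r2 by simp
    have "(1 - \<epsilon> / 2) * (\<Sum>A\<in>E. w A) \<le> ?c * (\<Sum>A\<in>E. w A)"
      using c T0 by (intro mult_right_mono) auto
    moreover have "\<epsilon> / 2 * (\<Sum>A\<in>E. w A) \<le> \<epsilon> / 2 * real (card V)"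
      using TN \<epsilon> by (intro mult_left_mono) auto
    ultimately have "(\<Sum>A\<in>E. w A) - \<epsilon> * real (card V) \<le> real (card M)"
      using M(3) by (simp add: algebra_simps)
    then show "\<exists>M\<subseteq>E. pairwise disjnt M \<and> (\<Sum>A\<in>E. w A) - \<epsilon> * real (card V) \<le> real (card M)"
      using M(1,2) by blast
  qed (rule d(1))
qed

section \<open>A fractional decomposition that omits few sets\<close>

lemma card_subsets_with_trace:
  assumes U: "finite U"
  shows "card {D. D \<subseteq> U \<and> card (D \<inter> Y) = i \<and> card (D - Y) = j} =
    (card (U \<inter> Y) choose i) * (card (U - Y) choose j)"
proof -
  let ?P = "{P. P \<subseteq> U \<inter> Y \<and> card P = i}" and ?Q = "{Q. Q \<subseteq> U - Y \<and> card Q = j}"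
  have "bij_betw (\<lambda>D. (D \<inter> Y, D - Y)) {D. D \<subseteq> U \<and> card (D \<inter> Y) = i \<and> card (D - Y) = j} (?P \<times> ?Q)"
  proof (rule bij_betw_byWitness[where f' = "\<lambda>(P, Q). P \<union> Q"])
    have "(P \<union> Q) \<inter> Y = P \<and> (P \<union> Q) - Y = Q" if "P \<in> ?P" "Q \<in> ?Q" for P Q
      using that by auto
    then show "\<forall>PQ\<in>?P \<times> ?Q. ((case PQ of (P, Q) \<Rightarrow> P \<union> Q) \<inter> Y, (case PQ of (P, Q) \<Rightarrow> P \<union> Q) - Y) = PQ"
      "(\<lambda>(P, Q). P \<union> Q) ` (?P \<times> ?Q) \<subseteq> {D. D \<subseteq> U \<and> card (D \<inter> Y) = i \<and> card (D - Y) = j}"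
      by auto
  qed auto
  then have "card {D. D \<subseteq> U \<and> card (D \<inter> Y) = i \<and> card (D - Y) = j} = card ?P * card ?Q"
    by (simp add: bij_betw_same_card card_cartesian_product)
  then show ?thesis by (simp only: n_subsets finite_Int finite_Diff U simp_thms)
qed

lemma sum_subsets_by_trace:
  fixes g :: "nat \<Rightarrow> real"
  assumes U: "finite U"
  shows "(\<Sum>D\<in>{D. D \<subseteq> U \<and> card D = t}. g (card (D \<inter> Y))) =
    (\<Sum>j\<le>t. g j * real ((card (U \<inter> Y) choose j) * (card (U - Y) choose (t - j))))"
proof -
  let ?S = "{D. D \<subseteq> U \<and> card D = t}"
  have fin: "finite D" if "D \<subseteq> U" for D using that U by (rule finite_subset)
  have split: "card D = card (D \<inter> Y) + card (D - Y)" if "D \<subseteq> U" for D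
    using card_Un_disjoint[of "D \<inter> Y" "D - Y"] fin[OF that] by (simp add: Int_Diff_disjoint Int_Diff_Un)
  have "(\<Sum>D\<in>?S. g (card (D \<inter> Y))) =
      (\<Sum>j\<le>t. \<Sum>D\<in>{D\<in>?S. card (D \<inter> Y) = j}. g (card (D \<inter> Y)))"
    by (rule sum.group[symmetric]) (use U split in auto)
  also have "\<dots> = (\<Sum>j\<le>t. g j * real ((card (U \<inter> Y) choose j) * (card (U - Y) choose (t - j))))"
  proof (rule sum.cong[OF refl])
    fix j assume j: "j \<in> {..t}"
    have "{D\<in>?S. card (D \<inter> Y) = j} = {D. D \<subseteq> U \<and> card (D \<inter> Y) = j \<and> card (D - Y) = t - j}"
      using split j by auto
    then have "card {D\<in>?S. card (D \<inter> Y) = j} = (card (U \<inter> Y) choose j) * (card (U - Y) choose (t - j))"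
      using card_subsets_with_trace[OF U] by simp
    then show "(\<Sum>D\<in>{D\<in>?S. card (D \<inter> Y) = j}. g (card (D \<inter> Y))) =
        g j * real ((card (U \<inter> Y) choose j) * (card (U - Y) choose (t - j)))"
      by (simp add: mult.commute)
  qed
  finally show ?thesis .
qed

lemma real_choose_2: "real (n choose 2) = real n * (real n - 1) / 2"
  by (induction n) (auto simp: numeral_2_eq_2 field_simps)

lemma real_choose_3: "real (n choose 3) = real n * (real n - 1) * (real n - 2) / 6"
proof (induction n)
  case (Suc n)
  have "Suc n choose 3 = (n choose 2) + (n choose 3)"
    using binomial_Suc_Suc[of n 2] by (simp add: numeral_3_eq_3 numeral_2_eq_2)
  then show ?case using Suc by (simp add: real_choose_2 field_simps)
qed simp

text \<open>The weight of an \<open>h\<close>-subset of an \<open>(h + 3)\<close>-set whose three missing points include exactly \<open>j\<close> points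
  of a fixed \<open>6\<close>-set; \<open>z = h - 3\<close> is the number of remaining points. It is the uniform weight plus
  a multiple of a third difference. In the uniform part, \<open>z + 4 choose 3\<close> is the number of triples
  that avoid a given pair. Distributing \<open>(-1) ^ j * (3 choose j)\<close> evenly over the \<open>j\<close>-th class
  changes neither the total nor the first two moments of \<open>j\<close>, and therefore does not change how often
  a pair of points is covered. The multiple \<open>20 = 6 choose 3\<close> is the one for which the weight vanishes at
  \<open>j = 3\<close>.\<close>

definition trace_weight :: "nat \<Rightarrow> nat \<Rightarrow> real" where
  "trace_weight z j =
    (1 + (-1) ^ j * 20 * real (3 choose j) / real ((6 choose j) * (z choose (3 - j)))) /
      real ((z + 4) choose 3)"

lemma trace_weight_values:
  "trace_weight z 0 = (1 + 20 / real (z choose 3)) / real ((z + 4) choose 3)"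
  "trace_weight z 1 = (1 - 10 / real (z choose 2)) / real ((z + 4) choose 3)"
  "trace_weight z 2 = (1 + 4 / real z) / real ((z + 4) choose 3)"
  "trace_weight z 3 = 0"
proof -
  have [simp]: "(6::nat) choose 2 = 15" "(6::nat) choose 3 = 20" "(3::nat) choose 2 = 3"
    by (simp_all add: eval_nat_numeral)
  show "trace_weight z 0 = (1 + 20 / real (z choose 3)) / real ((z + 4) choose 3)"
    "trace_weight z 1 = (1 - 10 / real (z choose 2)) / real ((z + 4) choose 3)"
    "trace_weight z 2 = (1 + 4 / real z) / real ((z + 4) choose 3)"
    "trace_weight z 3 = 0"
    by (simp_all add: trace_weight_def)
qed

lemma trace_weight_nonneg:
  assumes z: "5 \<le> z" and j: "j \<le> 3"
  shows "0 \<le> trace_weight z j"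
proof -
  have "real 5 * (real 5 - 1) \<le> real z * (real z - 1)"
    using z by (intro mult_mono) auto
  then have "10 / real (z choose 2) \<le> 1" by (simp add: real_choose_2)
  then have "0 \<le> trace_weight z 0" "0 \<le> trace_weight z 1" "0 \<le> trace_weight z 2" "0 \<le> trace_weight z 3"
    unfolding trace_weight_values by auto
  moreover have "j = 0 \<or> j = 1 \<or> j = 2 \<or> j = 3" using j by linarith
  ultimately show ?thesis by blast
qed

text \<open>The three cases \<open>u = 0, 1, 2\<close> are the pairs with \<open>2 - u\<close> points in the \<open>6\<close>-set: the three missing
  points are then chosen from the remaining \<open>4 + u\<close> points of the \<open>6\<close>-set and the remaining \<open>z - u\<close>
  points outside.\<close>

lemma sum_trace_weight:
  assumes z: "5 \<le> z" and u: "u \<le> 2"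
  shows "(\<Sum>j\<le>3. trace_weight z j * real (((4 + u) choose j) * ((z - u) choose (3 - j)))) = 1"
proof -
  define x where "x = real z"
  define w0 where "w0 = 1 + 20 / (x * (x - 1) * (x - 2) / 6)"
  define w1 where "w1 = 1 - 10 / (x * (x - 1) / 2)"
  define w2 where "w2 = 1 + 4 / x"
  define T where "T = (x + 4) * (x + 3) * (x + 2) / 6"
  have x: "x \<noteq> 0" "x - 1 \<noteq> 0" "x - 2 \<noteq> 0" and T: "T \<noteq> 0"
    using z by (auto simp: x_def T_def)
  have T_eq: "real (z + 4 choose 3) = T"
    by (simp add: real_choose_3 T_def x_def algebra_simps)
  have weights: "trace_weight z 0 = w0 / T" "trace_weight z (Suc 0) = w1 / T"
    "trace_weight z 2 = w2 / T" "trace_weight z 3 = 0"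
    unfolding trace_weight_values[unfolded One_nat_def] T_eq w0_def w1_def w2_def x_def
    by (simp_all add: real_choose_3 real_choose_2)
  have choose[simp]: "(4::nat) choose 2 = 6" "(4::nat) choose 3 = 4" "(5::nat) choose 2 = 10"
    "(5::nat) choose 3 = 10" "(6::nat) choose 2 = 15" "(6::nat) choose 3 = 20"
    by (simp_all add: eval_nat_numeral)
  have set: "{..3::nat} = {0, 1, 2, 3}" by auto
  have real_z: "real (z - u) = x - real u" using z u by (simp add: x_def of_nat_diff)
  have "(\<Sum>j\<le>3. trace_weight z j * real (((4 + u) choose j) * ((z - u) choose (3 - j)))) =
      (w0 * ((x - real u) * (x - real u - 1) * (x - real u - 2) / 6) +
       w1 * (real (4 + u) * ((x - real u) * (x - real u - 1) / 2)) +
       w2 * (real ((4 + u) choose 2) * (x - real u))) / T"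
    by (simp add: set weights real_z real_choose_3[of "z - u"] real_choose_2[of "z - u"] add_divide_distrib)
  also have "\<dots> = T / T"
  proof (rule arg_cong[where f = "\<lambda>y. y / T"])
    consider "u = 0" | "u = 1" | "u = 2" using u by linarith
    then show "w0 * ((x - real u) * (x - real u - 1) * (x - real u - 2) / 6) +
       w1 * (real (4 + u) * ((x - real u) * (x - real u - 1) / 2)) +
       w2 * (real ((4 + u) choose 2) * (x - real u)) = T"
      unfolding w0_def w1_def w2_def T_def using x
      by cases (simp_all add: divide_simps, simp_all add: algebra_simps)
  qed
  finally show ?thesis using T by simp
qed

text \<open>Every pair of points can be covered with total weight exactly \<open>1\<close> without the \<open>h\<close>-sets whose
  complement lies in \<open>Y\<close>, because three missing points leave enough freedom: the weight only has to
  imitate the first two moments of the trace on \<open>Y\<close>, and the values \<open>0, 1, 2\<close> suffice for that.\<close>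

lemma fractional_decomposition_avoiding_trace:
  assumes M: "finite M" "card M = h + 3" and h: "8 \<le> h" and Y: "Y \<subseteq> M" "card Y \<le> 6"
  shows "\<exists>x :: 'a set \<Rightarrow> real. (\<forall>A. 0 \<le> x A) \<and> (\<forall>A. A \<subseteq> M \<longrightarrow> M - A \<subseteq> Y \<longrightarrow> x A = 0) \<and>
    (\<forall>e. e \<subseteq> M \<longrightarrow> card e = 2 \<longrightarrow> (\<Sum>A\<in>{A. A \<subseteq> M \<and> card A = h \<and> e \<subseteq> A}. x A) = 1)"
proof -
  obtain Y' where Y': "Y \<subseteq> Y'" "Y' \<subseteq> M" "card Y' = 6"
    using exists_subset_between[of Y 6 M] M h Y by auto
  let ?x = "\<lambda>A. if card (M - A) = 3 then trace_weight (h - 3) (card ((M - A) \<inter> Y')) else 0"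
  have fin: "finite U" if "U \<subseteq> M" for U using that M(1) by (rule finite_subset)
  show ?thesis
  proof (intro exI[of _ ?x] conjI allI impI)
    fix A
    have "card ((M - A) \<inter> Y') \<le> card (M - A)" using M(1) by (intro card_mono) auto
    then show "0 \<le> ?x A" using h by (auto intro: trace_weight_nonneg)
  next
    fix A assume "A \<subseteq> M" "M - A \<subseteq> Y"
    then have "(M - A) \<inter> Y' = M - A" using Y' by blast
    then show "?x A = 0" by (simp add: trace_weight_values)
  next
    fix e assume e: "e \<subseteq> M" "card e = 2"
    \<comment> \<open>\<open>?u\<close> is the number of points of \<open>e\<close> outside the \<open>6\<close>-set.\<close>
    let ?u = "2 - card (e \<inter> Y')"
    have card_M_minus: "card (M - D) = h" if "D \<subseteq> M - e" "card D = 3" for D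
    proof -
      have "D \<subseteq> M" using that by blast
      then show ?thesis using that fin M by (simp add: card_Diff_subset)
    qed
    have ey: "card (e \<inter> Y') \<le> 2" "card (e - Y') = ?u"
      using card_mono[of e "e \<inter> Y'"] card_Diff_subset_Int[of e Y'] fin[OF e(1)] e by auto
    have "(\<Sum>A\<in>{A. A \<subseteq> M \<and> card A = h \<and> e \<subseteq> A}. ?x A) =
        (\<Sum>D\<in>{D. D \<subseteq> M - e \<and> card D = 3}. trace_weight (h - 3) (card (D \<inter> Y')))"
      by (rule sum.reindex_bij_witness[where i = "\<lambda>D. M - D" and j = "\<lambda>A. M - A"])
        (use e M fin in \<open>auto simp: card_Diff_subset double_diff card_M_minus\<close>)
    also have "\<dots> = (\<Sum>j\<le>3. trace_weight (h - 3) j *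
        real ((card ((M - e) \<inter> Y') choose j) * (card (M - e - Y') choose (3 - j))))"
      using M by (intro sum_subsets_by_trace) auto
    also have "card ((M - e) \<inter> Y') = 4 + ?u"
    proof -
      have "(M - e) \<inter> Y' = Y' - (e \<inter> Y')" using Y' by auto
      then show ?thesis using Y' fin ey by (simp add: card_Diff_subset)
    qed
    also have "card (M - e - Y') = h - 3 - ?u"
    proof -
      have "M - e - Y' = (M - Y') - (e - Y')" by auto
      then have "card (M - e - Y') = card (M - Y') - card (e - Y')"
        using e fin by (simp add: card_Diff_subset Diff_mono)
      then show ?thesis using M Y' fin ey by (simp add: card_Diff_subset)
    qed
    also have "(\<Sum>j\<le>3. trace_weight (h - 3) j *
        real (((4 + ?u) choose j) * ((h - 3 - ?u) choose (3 - j)))) = 1"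
      using h by (intro sum_trace_weight) auto
    finally show "(\<Sum>A\<in>{A. A \<subseteq> M \<and> card A = h \<and> e \<subseteq> A}. ?x A) = 1" .
  qed
qed

section \<open>Copies of a graph on slightly more vertices\<close>

lemma isomorphism_induced_restrict:
  assumes f: "isomorphism f (induced G A) H" and I: "I \<subseteq> A"
  shows "isomorphism f (induced G I) (induced H (f ` I))"
proof -
  have b: "bij_betw f A (verts H)"
    and e: "\<And>u v. u \<in> A \<Longrightarrow> v \<in> A \<Longrightarrow> {u, v} \<in> edges G \<longleftrightarrow> {f u, f v} \<in> edges H"
    using f by (auto simp: isomorphism_def induced_def)
  have "bij_betw f I (f ` I)"
    using b I by (auto simp: bij_betw_def intro: inj_on_subset)
  then show ?thesis
    using e I by (fastforce simp: isomorphism_def induced_def)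
qed

lemma isomorphism_inv:
  assumes "isomorphism f G H"
  shows "isomorphism (inv_into (verts G) f) H G"
proof -
  let ?g = "inv_into (verts G) f"
  have b: "bij_betw f (verts G) (verts H)"
    and e: "\<And>u v. u \<in> verts G \<Longrightarrow> v \<in> verts G \<Longrightarrow> {u, v} \<in> edges G \<longleftrightarrow> {f u, f v} \<in> edges H"
    using assms by (auto simp: isomorphism_def)
  have g: "bij_betw ?g (verts H) (verts G)" using b by (rule bij_betw_inv_into)
  have "{u, v} \<in> edges H \<longleftrightarrow> {?g u, ?g v} \<in> edges G" if "u \<in> verts H" "v \<in> verts H" for u v
    using e[of "?g u" "?g v"] that b g by (simp add: bij_betw_apply bij_betw_inv_into_right)
  then show ?thesis using g by (simp add: isomorphism_def)
qed

lemma isomorphism_comp: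
  assumes "isomorphism f G H" "isomorphism g H K"
  shows "isomorphism (g \<circ> f) G K"
  using assms unfolding isomorphism_def
  by (auto simp: bij_betw_apply intro: bij_betw_trans)

text \<open>The common part of two copies of \<open>H\<close> is carried to two large induced subgraphs of \<open>H\<close> that are
  isomorphic to each other, hence equal; composing one isomorphism with the inverse of the other
  gives an automorphism of that subgraph, hence the identity.\<close>

lemma copies_agree:
  assumes H: "induced_distinct_from H k"
    and f: "isomorphism f (induced G A) H" and g: "isomorphism g (induced G B) H"
    and k: "k \<le> card (A \<inter> B)" and v: "v \<in> A \<inter> B"
  shows "f v = g v"
proof -
  let ?I = "A \<inter> B"
  have f': "isomorphism f (induced G ?I) (induced H (f ` ?I))"
    using f by (rule isomorphism_induced_restrict) auto
  have g': "isomorphism g (induced G ?I) (induced H (g ` ?I))"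
    using g by (rule isomorphism_induced_restrict) auto
  have bf: "bij_betw f ?I (f ` ?I)" and bg: "bij_betw g ?I (g ` ?I)"
    using f' g' by (auto simp: isomorphism_def induced_def)
  have sub: "f ` ?I \<subseteq> verts H" "g ` ?I \<subseteq> verts H"
    using f g by (auto simp: isomorphism_def induced_def bij_betw_apply)
  have card: "k \<le> card (f ` ?I)" "k \<le> card (g ` ?I)"
    using k bij_betw_same_card[OF bf] bij_betw_same_card[OF bg] by auto
  have "isomorphic (induced H (f ` ?I)) (induced H (g ` ?I))"
    using isomorphism_comp[OF isomorphism_inv[OF f'] g'] unfolding isomorphic_def by blast
  then have eq: "f ` ?I = g ` ?I"
    using H sub card unfolding induced_distinct_from_def by blast
  have "isomorphism (g \<circ> inv_into ?I f) (induced H (f ` ?I)) (induced H (f ` ?I))"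
    using isomorphism_comp[OF isomorphism_inv[OF f'] g'] eq by (simp add: induced_def)
  moreover have "asymmetric (induced H (f ` ?I))"
    using H sub card unfolding induced_distinct_from_def by blast
  ultimately have "(g \<circ> inv_into ?I f) (f v) = f v"
    using v by (auto simp: asymmetric_def induced_def)
  then show ?thesis using bf v by (simp add: bij_betw_inv_into_left)
qed

text \<open>Any two \<open>h\<close>-subsets of an \<open>(h + 3)\<close>-set share at least \<open>h - 3\<close> points, so all copies of \<open>H\<close> agree on
  which vertex of \<open>H\<close> a point plays (the function \<open>\<phi>\<close>). Fix one copy \<open>A\<close>. Another copy that omits
  a point \<open>v\<close> of \<open>A\<close> must contain a point outside \<open>A\<close> that plays the same vertex of \<open>H\<close> as \<open>v\<close>.
  There are three points outside \<open>A\<close>, so besides these only three points can be omitted.\<close>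

lemma copies_complement_cover:
  assumes H: "H \<in> graphs h" "induced_distinct_from H k" and k: "k + 3 \<le> h"
    and M: "finite M" "card M = h + 3"
  shows "\<exists>Y\<subseteq>M. card Y \<le> 6 \<and> (\<forall>A\<subseteq>M. isomorphic (induced G A) H \<longrightarrow> M - A \<subseteq> Y)"
proof (cases "\<exists>A\<subseteq>M. isomorphic (induced G A) H")
  case False
  then show ?thesis by (intro exI[of _ "{}"]) auto
next
  case True
  let ?copy = "\<lambda>A f. A \<subseteq> M \<and> isomorphism f (induced G A) H"
  obtain A f where Af: "?copy A f" using True unfolding isomorphic_def by blast
  have bij: "bij_betw g B (verts H)" if "?copy B g" for B g
    using that by (simp add: isomorphism_def induced_def)
  have card: "card B = h" if "?copy B g" for B g
    using bij_betw_same_card[OF bij[OF that]] H by (simp add: graphs_def)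
  have fin: "finite B" if "B \<subseteq> M" for B using that M(1) by (rule finite_subset)
  have agree: "g v = g' v" if "?copy B g" "?copy B' g'" "v \<in> B" "v \<in> B'" for B B' g g' v
  proof -
    have "card (B \<union> B') \<le> h + 3" using that M card_mono[of M "B \<union> B'"] by auto
    then have "k \<le> card (B \<inter> B')"
      using card_Un_Int[of B B'] that fin card[OF that(1)] card[OF that(2)] k by auto
    then show ?thesis using copies_agree[OF H(2)] that by blast
  qed
  \<comment> \<open>The vertex of \<open>H\<close> that \<open>u\<close> plays in some copy, and hence in all copies that contain it.\<close>
  define \<phi> where "\<phi> u = (SOME i. \<exists>B g. ?copy B g \<and> u \<in> B \<and> i = g u)" for u
  have \<phi>: "\<phi> u = g u" if "?copy B g" "u \<in> B" for B g u
  proof -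
    have "\<exists>B g. ?copy B g \<and> u \<in> B \<and> \<phi> u = g u"
      unfolding \<phi>_def by (rule someI_ex) (use that in blast)
    then show ?thesis using agree that by metis
  qed
  \<comment> \<open>The point of \<open>A\<close> that plays the same vertex of \<open>H\<close> as \<open>u\<close>.\<close>
  define \<psi> where "\<psi> u = inv_into A f (\<phi> u)" for u
  let ?Y = "(M - A) \<union> (\<psi> ` (M - A) \<inter> M)"
  have cA: "card (M - A) = 3"
    using card[OF Af] M Af fin by (simp add: card_Diff_subset)
  have finY: "finite (M - A)" using M by simp
  have "card ?Y \<le> card (M - A) + card (\<psi> ` (M - A) \<inter> M)" by (rule card_Un_le)
  also have "card (\<psi> ` (M - A) \<inter> M) \<le> card (\<psi> ` (M - A))"
    using finY by (intro card_mono) auto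
  also have "\<dots> \<le> card (M - A)" using finY by (rule card_image_le)
  finally have "card ?Y \<le> 6" using cA by simp
  moreover have "M - B \<subseteq> ?Y" if B: "B \<subseteq> M" "isomorphic (induced G B) H" for B
  proof
    fix v assume v: "v \<in> M - B"
    obtain g where Bg: "?copy B g" using B unfolding isomorphic_def by blast
    show "v \<in> ?Y"
    proof (cases "v \<in> A")
      case True
      have "f v \<in> verts H" using bij[OF Af] True by (rule bij_betw_apply)
      then obtain u where u: "u \<in> B" "g u = f v"
        using bij[OF Bg] unfolding bij_betw_def by (metis imageE)
      have "u \<notin> A"
      proof
        assume "u \<in> A"
        then have "f u = f v" using agree[OF Af Bg _ u(1)] u by simp
        then have "u = v" using bij[OF Af] True \<open>u \<in> A\<close> by (auto simp: bij_betw_def inj_on_def)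
        then show False using u v by simp
      qed
      moreover have "\<psi> u = v"
        unfolding \<psi>_def \<phi>[OF Bg u(1)] u(2) using bij[OF Af] True by (rule bij_betw_inv_into_left)
      ultimately show ?thesis using u B v by auto
    qed (use v in auto)
  qed
  ultimately show ?thesis by (intro exI[of _ ?Y]) auto
qed

section \<open>From small decompositions to large packings\<close>

lemma card_supersets:
  assumes V: "finite V" "Z \<subseteq> V" and m: "card Z \<le> m"
  shows "card {M. M \<subseteq> V \<and> card M = m \<and> Z \<subseteq> M} = (card V - card Z choose (m - card Z))"
proof -
  have fin: "finite U" if "U \<subseteq> V" for U using that V(1) by (rule finite_subset)
  have "bij_betw (\<lambda>M. M - Z) {M. M \<subseteq> V \<and> card M = m \<and> Z \<subseteq> M} {N. N \<subseteq> V - Z \<and> card N = m - card Z}"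
  proof (rule bij_betw_byWitness[where f' = "\<lambda>N. N \<union> Z"])
    show "(\<lambda>M. M - Z) ` {M. M \<subseteq> V \<and> card M = m \<and> Z \<subseteq> M} \<subseteq> {N. N \<subseteq> V - Z \<and> card N = m - card Z}"
      using fin by (auto simp: card_Diff_subset)
    show "(\<lambda>N. N \<union> Z) ` {N. N \<subseteq> V - Z \<and> card N = m - card Z} \<subseteq> {M. M \<subseteq> V \<and> card M = m \<and> Z \<subseteq> M}"
    proof clarsimp
      fix N assume N: "N \<subseteq> V - Z" "card N = m - card Z"
      then have "finite N" "finite Z" "N \<inter> Z = {}" using fin V by auto
      then show "N \<subseteq> V \<and> Z \<subseteq> V \<and> card (N \<union> Z) = m"
        using N V m by (auto simp: card_Un_disjoint)
    qed
  qed auto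
  then have "card {M. M \<subseteq> V \<and> card M = m \<and> Z \<subseteq> M} = card {N. N \<subseteq> V - Z \<and> card N = m - card Z}"
    by (rule bij_betw_same_card)
  also have "\<dots> = (card (V - Z) choose (m - card Z))"
    using V by (intro n_subsets) auto
  also have "card (V - Z) = card V - card Z"
    using V fin by (simp add: card_Diff_subset)
  finally show ?thesis .
qed

text \<open>The pairs of points are covered exactly, by weighted \<open>h\<close>-sets from \<open>F\<close>; the bound on triples is the
  codegree bound for the hypergraph whose vertices are the pairs, because two distinct pairs span at
  least three points.\<close>

definition fractional_clique_decomposition ::
  "'a set \<Rightarrow> nat \<Rightarrow> 'a set set \<Rightarrow> ('a set \<Rightarrow> real) \<Rightarrow> real \<Rightarrow> bool" where
  "fractional_clique_decomposition V h F y d \<longleftrightarrow>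
     (\<forall>A\<in>F. A \<subseteq> V \<and> card A = h \<and> 0 \<le> y A) \<and>
     (\<forall>e. e \<subseteq> V \<longrightarrow> card e = 2 \<longrightarrow> (\<Sum>A\<in>{A\<in>F. e \<subseteq> A}. y A) = 1) \<and>
     (\<forall>Z. Z \<subseteq> V \<longrightarrow> 3 \<le> card Z \<longrightarrow> (\<Sum>A\<in>{A\<in>F. Z \<subseteq> A}. y A) \<le> d)"

lemma fractional_clique_decomposition_mono:
  assumes "fractional_clique_decomposition V h F y d" "d \<le> d'"
  shows "fractional_clique_decomposition V h F y d'"
  using assms unfolding fractional_clique_decomposition_def by (meson order_trans)

text \<open>The decompositions of all \<open>m\<close>-subsets are averaged. A pair lies in \<open>n - 2 choose (m - 2)\<close> of
  them and a triple only in \<open>n - 3 choose (m - 3)\<close>, where \<open>n = card V\<close>; for fixed \<open>m\<close> their quotient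
  tends to \<open>0\<close> as \<open>n\<close> grows.\<close>

lemma average_of_local_decompositions:
  fixes F :: "'a set set"
  assumes V: "finite V" "m \<le> card V" and m: "3 \<le> m"
    and F: "\<And>A. A \<in> F \<Longrightarrow> A \<subseteq> V \<and> card A = h"
    and local: "\<And>M. M \<subseteq> V \<Longrightarrow> card M = m \<Longrightarrow>
      \<exists>x :: 'a set \<Rightarrow> real. (\<forall>A. 0 \<le> x A) \<and> (\<forall>A. A \<subseteq> M \<longrightarrow> A \<notin> F \<longrightarrow> x A = 0) \<and>
        (\<forall>e. e \<subseteq> M \<longrightarrow> card e = 2 \<longrightarrow> (\<Sum>A\<in>{A. A \<subseteq> M \<and> card A = h \<and> e \<subseteq> A}. x A) = 1)"
  shows "\<exists>y. fractional_clique_decomposition V h F y ((real m - 2) / (real (card V) - 2))"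
proof -
  let ?Ms = "{M. M \<subseteq> V \<and> card M = m}"
  let ?n = "card V"
  let ?C = "real (?n - 2 choose (m - 2))"
  let ?local = "\<lambda>M x. (\<forall>A. 0 \<le> (x A :: real)) \<and> (\<forall>A. A \<subseteq> M \<longrightarrow> A \<notin> F \<longrightarrow> x A = 0) \<and>
        (\<forall>e. e \<subseteq> M \<longrightarrow> card e = 2 \<longrightarrow> (\<Sum>A\<in>{A. A \<subseteq> M \<and> card A = h \<and> e \<subseteq> A}. x A) = 1)"
  have "\<forall>M\<in>?Ms. \<exists>x. ?local M x"
    using local by simp
  then have "\<exists>x. \<forall>M\<in>?Ms. ?local M (x M)" by (rule bchoice)
  then obtain x where x_local: "\<forall>M\<in>?Ms. ?local M (x M)" ..
  have x: "0 \<le> x M A" if "M \<in> ?Ms" for M A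
    using bspec[OF x_local that] by (elim conjE) simp
  have x0: "x M A = 0" if "M \<in> ?Ms" "A \<subseteq> M" "A \<notin> F" for M A
    using bspec[OF x_local that(1)] that(2,3) by (elim conjE) simp
  have x1: "(\<Sum>A\<in>{A. A \<subseteq> M \<and> card A = h \<and> e \<subseteq> A}. x M A) = 1"
    if "M \<in> ?Ms" "e \<subseteq> M" "card e = 2" for M e
    using bspec[OF x_local that(1)] that(2,3) by (elim conjE) simp
  have finMs: "finite ?Ms" using V by simp
  have finF: "finite F" by (rule finite_subset[of _ "Pow V"]) (use F V in auto)
  have C: "?C > 0" using V by simp
  define y where "y A = (\<Sum>M\<in>{M\<in>?Ms. A \<subseteq> M}. x M A) / ?C" for A
  have swap: "(\<Sum>A\<in>{A\<in>F. U \<subseteq> A}. y A) = (\<Sum>M\<in>{M\<in>?Ms. U \<subseteq> M}. \<Sum>A\<in>{A\<in>F. U \<subseteq> A \<and> A \<subseteq> M}. x M A) / ?C" for U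
  proof -
    have "(\<Sum>A\<in>{A\<in>F. U \<subseteq> A}. y A) = (\<Sum>A\<in>{A\<in>F. U \<subseteq> A}. \<Sum>M\<in>{M\<in>?Ms. A \<subseteq> M}. x M A) / ?C"
      by (simp add: y_def sum_divide_distrib)
    also have "(\<Sum>A\<in>{A\<in>F. U \<subseteq> A}. \<Sum>M\<in>{M\<in>?Ms. A \<subseteq> M}. x M A) =
        (\<Sum>M\<in>?Ms. \<Sum>A\<in>{A\<in>{A\<in>F. U \<subseteq> A}. A \<subseteq> M}. x M A)"
      using finMs finF by (intro sum.swap_restrict) auto
    also have "\<dots> = (\<Sum>M\<in>{M\<in>?Ms. U \<subseteq> M}. \<Sum>A\<in>{A\<in>{A\<in>F. U \<subseteq> A}. A \<subseteq> M}. x M A)"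
      using finMs by (intro sum.mono_neutral_right) (auto intro!: sum.neutral)
    finally show ?thesis by (simp add: conj_assoc)
  qed
  have inner: "(\<Sum>A\<in>{A\<in>F. e \<subseteq> A \<and> A \<subseteq> M}. x M A) = 1"
    if M: "M \<in> ?Ms" and e: "e \<subseteq> M" "card e = 2" for M e
  proof -
    have "finite M" using M V by (auto intro: finite_subset)
    then have "(\<Sum>A\<in>{A\<in>F. e \<subseteq> A \<and> A \<subseteq> M}. x M A) = (\<Sum>A\<in>{A. A \<subseteq> M \<and> card A = h \<and> e \<subseteq> A}. x M A)"
      using F x0[OF M] by (intro sum.mono_neutral_left) auto
    then show ?thesis using x1[OF M e] by simp
  qed
  show ?thesis
    unfolding fractional_clique_decomposition_def
  proof (intro exI[of _ y] conjI ballI allI impI)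
    fix A assume "A \<in> F"
    then show "A \<subseteq> V" "card A = h" using F by auto
    show "0 \<le> y A" using x C unfolding y_def by (intro divide_nonneg_nonneg sum_nonneg) auto
  next
    fix e assume e: "e \<subseteq> V" "card e = 2"
    have "(\<Sum>A\<in>{A\<in>F. e \<subseteq> A}. y A) = (\<Sum>M\<in>{M\<in>?Ms. e \<subseteq> M}. 1) / ?C"
      unfolding swap using inner e by (intro arg_cong[where f = "\<lambda>t. t / ?C"] sum.cong) auto
    also have "\<dots> = real (card {M\<in>?Ms. e \<subseteq> M}) / ?C" by simp
    also have "{M\<in>?Ms. e \<subseteq> M} = {M. M \<subseteq> V \<and> card M = m \<and> e \<subseteq> M}" by auto
    also have "card \<dots> = (?n - 2 choose (m - 2))"
      using card_supersets[of V e m] V e m by simp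
    finally show "(\<Sum>A\<in>{A\<in>F. e \<subseteq> A}. y A) = 1" using C by simp
  next
    fix Z assume Z: "Z \<subseteq> V" "3 \<le> card Z"
    obtain Z' where Z': "Z' \<subseteq> Z" "card Z' = 3"
      by (rule obtain_subset_with_card_n[OF Z(2)])
    \<comment> \<open>All cliques through \<open>Z\<close> in a given \<open>M\<close> cover the pair \<open>e\<close>, which has weight \<open>1\<close> there.\<close>
    obtain e where e: "e \<subseteq> Z'" "card e = 2"
      by (rule obtain_subset_with_card_n[of 2 Z']) (use Z'(2) in simp_all)
    have "(\<Sum>M\<in>{M\<in>?Ms. Z \<subseteq> M}. \<Sum>A\<in>{A\<in>F. Z \<subseteq> A \<and> A \<subseteq> M}. x M A) \<le> (\<Sum>M\<in>{M\<in>?Ms. Z \<subseteq> M}. 1)"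
    proof (rule sum_mono)
      fix M assume M: "M \<in> {M\<in>?Ms. Z \<subseteq> M}"
      have M': "M \<in> ?Ms" "Z \<subseteq> M" using M by simp_all
      have "{A\<in>F. Z \<subseteq> A \<and> A \<subseteq> M} \<subseteq> {A\<in>F. e \<subseteq> A \<and> A \<subseteq> M}"
        using e(1) Z'(1) by blast
      then have "(\<Sum>A\<in>{A\<in>F. Z \<subseteq> A \<and> A \<subseteq> M}. x M A) \<le> (\<Sum>A\<in>{A\<in>F. e \<subseteq> A \<and> A \<subseteq> M}. x M A)"
        using x[OF M'(1)] finF by (intro sum_mono2) simp_all
      also have "\<dots> = 1"
      proof (rule inner[OF M'(1) _ e(2)])
        show "e \<subseteq> M" using e(1) Z'(1) M'(2) by blast
      qed
      finally show "(\<Sum>A\<in>{A\<in>F. Z \<subseteq> A \<and> A \<subseteq> M}. x M A) \<le> 1" .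
    qed
    also have "\<dots> = real (card {M\<in>?Ms. Z \<subseteq> M})" by simp
    also have "\<dots> \<le> real (?n - 3 choose (m - 3))"
    proof -
      have "card {M\<in>?Ms. Z \<subseteq> M} \<le> card {M. M \<subseteq> V \<and> card M = m \<and> Z' \<subseteq> M}"
      proof (rule card_mono)
        show "finite {M. M \<subseteq> V \<and> card M = m \<and> Z' \<subseteq> M}"
          by (rule finite_subset[OF _ finMs]) blast
        show "{M\<in>?Ms. Z \<subseteq> M} \<subseteq> {M. M \<subseteq> V \<and> card M = m \<and> Z' \<subseteq> M}"
          using Z'(1) by blast
      qed
      also have "\<dots> = (?n - 3 choose (m - 3))"
        using card_supersets[OF V(1) subset_trans[OF Z'(1) Z(1)], of m] m unfolding Z'(2) by blast
      finally show ?thesis by (rule of_nat_mono)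
    qed
    finally have "(\<Sum>A\<in>{A\<in>F. Z \<subseteq> A}. y A) \<le> real (?n - 3 choose (m - 3)) / ?C"
      unfolding swap by (rule divide_right_mono) simp
    also have "\<dots> = (real m - 2) / (real ?n - 2)"
    proof -
      obtain a b where ab: "m = a + 3" "?n = b + 3" using m V(2) by (metis add.commute le_Suc_ex le_trans)
      have "real (Suc a) * real (Suc b choose Suc a) = real (Suc b) * real (b choose a)"
        using Suc_times_binomial[of a b] by (metis of_nat_mult)
      moreover have "?C = real (Suc b choose Suc a)" "real (?n - 3 choose (m - 3)) = real (b choose a)"
        by (simp_all add: ab numeral_3_eq_3 numeral_2_eq_2)
      moreover have "real m - 2 = real (Suc a)" "real ?n - 2 = real (Suc b)" by (simp_all add: ab)
      ultimately show ?thesis using C by (simp only:) (simp add: divide_simps mult_ac)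
    qed
    finally show "(\<Sum>A\<in>{A\<in>F. Z \<subseteq> A}. y A) \<le> (real m - 2) / (real ?n - 2)" .
  qed
qed

lemma finite_all_edges: "finite V \<Longrightarrow> finite (all_edges V)"
  by (rule finite_subset[of _ "Pow V"]) (auto simp: all_edges_def)

lemma card_all_edges: "finite V \<Longrightarrow> card (all_edges V) = card V choose 2"
  by (simp add: all_edges_def n_subsets)

lemma Union_all_edges:
  assumes "2 \<le> card A"
  shows "\<Union> (all_edges A) = A"
proof (intro equalityI subsetI)
  fix v assume v: "v \<in> A"
  have "A \<noteq> {v}" using assms by auto
  then obtain u where "u \<in> A" "u \<noteq> v" using v by blast
  then have "{u, v} \<in> all_edges A" using v by (simp add: all_edges_def)
  then show "v \<in> \<Union> (all_edges A)" by blast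
qed (auto simp: all_edges_def)

text \<open>Rounding is applied to the hypergraph whose vertices are the pairs of points, an \<open>h\<close>-set \<open>A\<close> being
  turned into the edge \<open>all_edges A\<close>; disjoint edges are edge-disjoint cliques.\<close>

lemma fractional_to_integral_packing:
  assumes h: "3 \<le> h" and \<epsilon>: "0 < \<epsilon>"
  shows "\<exists>d>0. \<forall>V F y. finite V \<longrightarrow> fractional_clique_decomposition V h F y d \<longrightarrow>
      (\<exists>P\<subseteq>F. pairwise (\<lambda>S T. disjnt (all_edges S) (all_edges T)) P \<and>
        real (card V choose 2) / real (h choose 2) * (1 - \<epsilon>) \<le> real (card P))"
proof -
  let ?r = "h choose 2"
  have "real 3 * (real 3 - 1) \<le> real h * (real h - 1)"
    using h by (intro mult_mono) auto
  then have "2 \<le> real ?r" by (simp add: real_choose_2)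
  then have r: "2 \<le> ?r" by linarith
  then have r0: "0 < real ?r" by linarith
  have \<epsilon>': "0 < \<epsilon> / real ?r" using \<epsilon> r0 by (rule divide_pos_pos)
  obtain d where d: "d > 0" "\<And>(V :: nat set set) E w. fractional_matching ?r d V E w \<Longrightarrow>
    \<exists>M\<subseteq>E. pairwise disjnt M \<and> (\<Sum>A\<in>E. w A) - \<epsilon> / real ?r * real (card V) \<le> real (card M)"
    using fractional_matching_rounding[OF r \<epsilon>', where ?'a = "nat set"] by blast
  show ?thesis
  proof (intro exI[of _ d] conjI allI impI)
    fix V :: "nat set" and F :: "nat set set" and y :: "nat set \<Rightarrow> real"
    assume V: "finite V" and y: "fractional_clique_decomposition V h F y d"
    have F: "A \<subseteq> V" "card A = h" "0 \<le> y A" if "A \<in> F" for A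
      using y that by (auto simp: fractional_clique_decomposition_def)
    have cover: "(\<Sum>A\<in>{A\<in>F. e \<subseteq> A}. y A) = 1" if "e \<subseteq> V" "card e = 2" for e
      using y that by (auto simp: fractional_clique_decomposition_def)
    have codeg: "(\<Sum>A\<in>{A\<in>F. Z \<subseteq> A}. y A) \<le> d" if "Z \<subseteq> V" "3 \<le> card Z" for Z
      using y that by (auto simp: fractional_clique_decomposition_def)
    let ?E = "all_edges ` F" and ?w = "\<lambda>B. y (\<Union> B)"
    have finA: "finite A" if "A \<in> F" for A using F(1)[OF that] V by (rule finite_subset)
    have finF: "finite F" by (rule finite_subset[of _ "Pow V"]) (use F V in auto)
    have Un: "\<Union> (all_edges A) = A" if "A \<in> F" for A using that F h by (simp add: Union_all_edges)
    have inj: "inj_on all_edges F" using Un by (rule inj_on_inverseI)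
    have reindex: "(\<Sum>B\<in>{B\<in>?E. Q B}. ?w B) = (\<Sum>A\<in>{A\<in>F. Q (all_edges A)}. y A)" for Q
    proof -
      have "{B\<in>?E. Q B} = all_edges ` {A\<in>F. Q (all_edges A)}" by auto
      moreover have "inj_on all_edges {A\<in>F. Q (all_edges A)}" using inj by (rule inj_on_subset) auto
      ultimately show ?thesis using Un by (simp add: sum.reindex)
    qed
    have mem: "e \<in> all_edges A \<longleftrightarrow> e \<subseteq> A" if "e \<in> all_edges V" for e A
      using that by (simp add: all_edges_def)
    have frac: "fractional_matching ?r d (all_edges V) ?E ?w"
      unfolding fractional_matching_def reindex
    proof (intro conjI ballI impI)
      fix B assume "B \<in> ?E"
      then obtain A where A: "A \<in> F" "B = all_edges A" by auto
      then show "B \<subseteq> all_edges V" "card B = ?r" "0 \<le> ?w B"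
        using F[OF A(1)] finA[OF A(1)] Un[OF A(1)] by (auto simp: card_all_edges) (auto simp: all_edges_def)
    next
      fix e assume e: "e \<in> all_edges V"
      then show "(\<Sum>A\<in>{A\<in>F. e \<in> all_edges A}. y A) \<le> 1"
        using cover by (simp add: mem[OF e] all_edges_def)
    next
      fix e e' assume e: "e \<in> all_edges V" "e' \<in> all_edges V" "e \<noteq> e'"
      have fin: "finite e" "finite e'" using e V by (auto simp: all_edges_def intro: finite_subset)
      have "3 \<le> card (e \<union> e')"
      proof (rule ccontr)
        assume "\<not> 3 \<le> card (e \<union> e')"
        then have "card (e \<union> e') \<le> card e" "card (e \<union> e') \<le> card e'"
          using e by (auto simp: all_edges_def)
        then have "e \<union> e' = e" "e \<union> e' = e'"
          using fin card_seteq[of "e \<union> e'"] by auto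
        then show False using e by auto
      qed
      moreover have "e \<union> e' \<subseteq> V" using e by (auto simp: all_edges_def)
      ultimately have "(\<Sum>A\<in>{A\<in>F. e \<union> e' \<subseteq> A}. y A) \<le> d" by (intro codeg)
      then show "(\<Sum>A\<in>{A\<in>F. e \<in> all_edges A \<and> e' \<in> all_edges A}. y A) \<le> d"
        by (simp add: mem[OF e(1)] mem[OF e(2)])
    qed (rule finite_all_edges[OF V])
    obtain M where M: "M \<subseteq> ?E" "pairwise disjnt M"
      "(\<Sum>B\<in>?E. ?w B) - \<epsilon> / real ?r * real (card (all_edges V)) \<le> real (card M)"
      using d(2)[OF frac] by (elim exE conjE)
    have total: "real ?r * (\<Sum>B\<in>?E. ?w B) = real (card V choose 2)"
    proof -
      have "real (card V choose 2) = (\<Sum>e\<in>all_edges V. \<Sum>A\<in>{A\<in>F. e \<subseteq> A}. y A)"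
        using cover card_all_edges[OF V] by (simp add: all_edges_def)
      also have "\<dots> = (\<Sum>A\<in>F. \<Sum>e\<in>{e\<in>all_edges V. e \<subseteq> A}. y A)"
        using finite_all_edges[OF V] finF by (rule sum.swap_restrict)
      also have "\<dots> = (\<Sum>A\<in>F. real ?r * y A)"
      proof (rule sum.cong[OF refl])
        fix A assume A: "A \<in> F"
        have "{e\<in>all_edges V. e \<subseteq> A} = all_edges A" using F(1)[OF A] by (auto simp: all_edges_def)
        then show "(\<Sum>e\<in>{e\<in>all_edges V. e \<subseteq> A}. y A) = real ?r * y A"
          using A F finA card_all_edges by simp
      qed
      also have "\<dots> = real ?r * (\<Sum>B\<in>?E. ?w B)"
        using reindex[of "\<lambda>_. True"] by (simp add: sum_distrib_left)
      finally show ?thesis by simp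
    qed
    define P where "P = {A\<in>F. all_edges A \<in> M}"
    have "M = all_edges ` P" using M(1) by (auto simp: P_def)
    moreover have injP: "inj_on all_edges P" using inj by (rule inj_on_subset) (auto simp: P_def)
    ultimately have card: "card M = card P" by (simp add: card_image)
    have "pairwise (\<lambda>S T. disjnt (all_edges S) (all_edges T)) P"
    proof (rule pairwiseI)
      fix S T assume ST: "S \<in> P" "T \<in> P" "S \<noteq> T"
      then have "all_edges S \<noteq> all_edges T" using injP by (simp add: inj_on_eq_iff)
      moreover have "all_edges S \<in> M" "all_edges T \<in> M" using ST by (simp_all add: P_def)
      ultimately show "disjnt (all_edges S) (all_edges T)" by (intro pairwiseD[OF M(2)])
    qed
    moreover have "real (card V choose 2) / real ?r * (1 - \<epsilon>) \<le> real (card P)"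
    proof -
      have "(\<Sum>B\<in>?E. ?w B) = real (card V choose 2) / real ?r"
        
        unfolding total[symmetric] using r0 by (intro nonzero_mult_div_cancel_left[symmetric]) linarith
      then show ?thesis using M(3) unfolding card card_all_edges[OF V]
        by (simp add: algebra_simps diff_divide_distrib)
    qed
    ultimately show "\<exists>P\<subseteq>F. pairwise (\<lambda>S T. disjnt (all_edges S) (all_edges T)) P \<and>
        real (card V choose 2) / real ?r * (1 - \<epsilon>) \<le> real (card P)"
      by (intro exI[of _ P]) (auto simp: P_def)
  qed (rule d(1))
qed

section \<open>Avoidability\<close>

lemma induced_in_graphs:
  assumes "G \<in> graphs n" "S \<subseteq> verts G" "card S = k"
  shows "induced G S \<in> graphs k"
  using assms by (auto simp: graphs_def induced_def all_edges_def intro: finite_subset)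

text \<open>A graph on \<open>k\<close> vertices that is not isomorphic to \<open>C\<close> represents a coloring other than the class
  of \<open>C\<close>, so its induced copy serves as its own witness.\<close>

lemma is_packing_avoiding:
  assumes G: "G \<in> graphs n" and C: "C \<in> graphs k"
    and P: "\<And>S. S \<in> P \<Longrightarrow> S \<subseteq> verts G \<and> card S = k \<and> \<not> isomorphic (induced G S) C"
      "pairwise (\<lambda>S T. disjnt (all_edges S) (all_edges T)) P"
  shows "is_packing k (colorings k - {iso_class k C}) G P"
proof -
  have "\<exists>D\<in>\<Union> (colorings k - {iso_class k C}). isomorphic (induced G S) D" if S: "S \<in> P" for S
  proof -
    let ?I = "induced G S"
    have I: "?I \<in> graphs k" using induced_in_graphs[OF G] P(1)[OF S] by blast
    then have "iso_class k ?I \<in> colorings k" "?I \<in> iso_class k ?I"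
      by (auto simp: colorings_def iso_class_def quotient_def iso_rel_def isomorphic_refl)
    moreover have "?I \<notin> iso_class k C"
      using P(1)[OF S] unfolding iso_class_def iso_rel_def by (blast intro: isomorphic_sym)
    ultimately show ?thesis using isomorphic_refl by (intro bexI[of _ ?I]) auto
  qed
  then show ?thesis using P unfolding is_packing_def by blast
qed

text \<open>Every \<open>h + 3\<close> vertices of \<open>G\<close> have a fractional decomposition into sets that do not induce \<open>H\<close>. The
  average of these over \<open>n\<close> vertices puts weight at most \<open>(h + 1) / (n - 2)\<close> on any triple, which
  falls below the threshold \<open>d\<close> for rounding once \<open>n\<close> is large.\<close>

lemma avoidable_if_induced_distinct:
  assumes H: "H \<in> graphs h" "induced_distinct_from H k" and k: "k + 3 \<le> h" and h: "8 \<le> h"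
  shows "avoidable h H"
  unfolding avoidable_def asymptotic_packing_property_def
proof (intro allI impI)
  fix \<epsilon> :: real assume \<epsilon>: "0 < \<epsilon>"
  have "3 \<le> h" using h by simp
  then obtain d where d: "0 < d" "\<And>V F y. finite V \<Longrightarrow> fractional_clique_decomposition V h F y d \<Longrightarrow>
      \<exists>P\<subseteq>F. pairwise (\<lambda>S T. disjnt (all_edges S) (all_edges T)) P \<and>
        real (card V choose 2) / real (h choose 2) * (1 - \<epsilon>) \<le> real (card P)"
    using fractional_to_integral_packing[OF _ \<epsilon>, of h] by blast
  let ?m = "h + 3"
  obtain n0 :: nat where n0: "(real ?m - 2) / d + 2 \<le> real n0" using real_arch_simple by blast
  show "\<forall>\<^sub>F n in sequentially. \<forall>G\<in>graphs n. \<exists>P. is_packing h (colorings h - {iso_class h H}) G P \<and>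
        real n * (real n - 1) / (real h * (real h - 1)) * (1 - \<epsilon>) \<le> real (card P)"
    unfolding eventually_sequentially
  proof (intro exI[of _ "max n0 ?m"] allI impI ballI)
    fix n G assume n: "max n0 ?m \<le> n" and G: "G \<in> graphs n"
    let ?V = "verts G"
    let ?F = "{A. A \<subseteq> ?V \<and> card A = h \<and> \<not> isomorphic (induced G A) H}"
    have V: "finite ?V" "card ?V = n" using G by (auto simp: graphs_def)
    have local: "\<exists>x :: nat set \<Rightarrow> real. (\<forall>A. 0 \<le> x A) \<and> (\<forall>A. A \<subseteq> M \<longrightarrow> A \<notin> ?F \<longrightarrow> x A = 0) \<and>
        (\<forall>e. e \<subseteq> M \<longrightarrow> card e = 2 \<longrightarrow> (\<Sum>A\<in>{A. A \<subseteq> M \<and> card A = h \<and> e \<subseteq> A}. x A) = 1)"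
      if M: "M \<subseteq> ?V" "card M = ?m" for M
    proof -
      have finM: "finite M" using M(1) V(1) by (rule finite_subset)
      obtain Y where Y: "Y \<subseteq> M" "card Y \<le> 6"
        "\<forall>A\<subseteq>M. isomorphic (induced G A) H \<longrightarrow> M - A \<subseteq> Y"
        using copies_complement_cover[OF H k finM M(2), of G] by (elim exE conjE)
      obtain x :: "nat set \<Rightarrow> real" where x: "\<forall>A. 0 \<le> x A" "\<forall>A. A \<subseteq> M \<longrightarrow> M - A \<subseteq> Y \<longrightarrow> x A = 0"
        "\<forall>e. e \<subseteq> M \<longrightarrow> card e = 2 \<longrightarrow> (\<Sum>A\<in>{A. A \<subseteq> M \<and> card A = h \<and> e \<subseteq> A}. x A) = 1"
        using fractional_decomposition_avoiding_trace[OF finM M(2) h Y(1,2)] by (elim exE conjE)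
      \<comment> \<open>Subsets of other sizes are not in \<open>?F\<close> either and need weight \<open>0\<close>.\<close>
      let ?x = "\<lambda>A. if card A = h then x A else 0"
      have "(\<Sum>A\<in>{A. A \<subseteq> M \<and> card A = h \<and> e \<subseteq> A}. ?x A) = 1" if "e \<subseteq> M" "card e = 2" for e
      proof -
        have "(\<Sum>A\<in>{A. A \<subseteq> M \<and> card A = h \<and> e \<subseteq> A}. ?x A) = (\<Sum>A\<in>{A. A \<subseteq> M \<and> card A = h \<and> e \<subseteq> A}. x A)"
          by (intro sum.cong) simp_all
        then show ?thesis using x(3)[rule_format, OF that] by (rule trans)
      qed
      moreover have "?x A = 0" if A: "A \<subseteq> M" "A \<notin> ?F" for A
      proof (cases "card A = h")
        case True
        then have "isomorphic (induced G A) H" using A M(1) by blast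
        then show ?thesis using x(2)[rule_format, OF A(1)] Y(3)[rule_format, OF A(1)] by simp
      qed simp
      ultimately show ?thesis using x(1) by (intro exI[of _ ?x]) auto
    qed
    have "\<exists>y. fractional_clique_decomposition ?V h ?F y ((real ?m - 2) / (real (card ?V) - 2))"
      by (rule average_of_local_decompositions[OF V(1) _ _ _ local]) (use V(2) n in simp_all)
    then obtain y where y: "fractional_clique_decomposition ?V h ?F y ((real ?m - 2) / (real n - 2))"
      unfolding V(2) ..
    have "(real ?m - 2) / d \<le> real n - 2" using n0 n by (simp add: max_def split: if_splits)
    then have "(real ?m - 2) / (real n - 2) \<le> d"
      using d(1) n by (simp add: field_simps)
    with y have decomp: "fractional_clique_decomposition ?V h ?F y d"
      by (rule fractional_clique_decomposition_mono)
    obtain P where P: "P \<subseteq> ?F" "pairwise (\<lambda>S T. disjnt (all_edges S) (all_edges T)) P"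
      "real (card ?V choose 2) / real (h choose 2) * (1 - \<epsilon>) \<le> real (card P)"
      using d(2)[OF V(1) decomp] by (elim exE conjE)
    have "is_packing h (colorings h - {iso_class h H}) G P"
      by (rule is_packing_avoiding[OF G H(1) _ P(2)]) (use P(1) in auto)
    moreover have "real n * (real n - 1) / (real h * (real h - 1)) * (1 - \<epsilon>) \<le> real (card P)"
      using P(3) by (simp add: V(2) real_choose_2)
    ultimately show "\<exists>P. is_packing h (colorings h - {iso_class h H}) G P \<and>
        real n * (real n - 1) / (real h * (real h - 1)) * (1 - \<epsilon>) \<le> real (card P)" by blast
  qed
qed

theorem lemma3p6:
  fixes \<gamma> :: real
  assumes "\<gamma> > 0"
  shows "\<exists>h0. \<forall>h\<ge>h0. \<forall>H\<in>graphs h.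
    ereal_of_enat (asym_index H) \<le> ereal ((1 - \<gamma>) * real h) \<longrightarrow> avoidable h H"
proof -
  obtain h0 :: nat where h0: "3 / \<gamma> \<le> real h0" using real_arch_simple by blast
  show ?thesis
  proof (intro exI[of _ "max 8 h0"] allI impI ballI)
    fix h H assume h: "max 8 h0 \<le> h" and H: "H \<in> graphs h"
      and index: "ereal_of_enat (asym_index H) \<le> ereal ((1 - \<gamma>) * real h)"
    let ?k = "LEAST k. k > 0 \<and> induced_distinct_from H k"
    have "finite (verts H)" using H by (simp add: graphs_def)
    then have "0 < Suc (card (verts H)) \<and> induced_distinct_from H (Suc (card (verts H)))"
      using induced_distinct_from_Suc_card by simp
    then have "0 < ?k \<and> induced_distinct_from H ?k" by (rule LeastI)
    moreover have "?k + 3 \<le> h"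
    proof -
      have "asym_index H = enat ?k"
        using index by (auto simp: asym_index_def split: if_splits)
      then have "real ?k \<le> (1 - \<gamma>) * real h" using index by simp
      moreover have "3 \<le> \<gamma> * real h"
      proof -
        have "3 / \<gamma> \<le> real h" using h0 h by linarith
        then show ?thesis using assms by (simp add: field_simps)
      qed
      ultimately have "real ?k + 3 \<le> real h" by (simp add: algebra_simps)
      then show ?thesis by linarith
    qed
    ultimately show "avoidable h H"
      using avoidable_if_induced_distinct[OF H, of ?k] h by simp
  qed
qed

end
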